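(* Let $n,l\in\mathbb N$, $k\ge0$, and for $j=1,\dots,l$ let $\alpha^j=(\alpha^j_1,\dots,\alpha^j_n)$ be $n$-tuples of non-negative integers with $|\alpha^j|=\sum_i\alpha^j_i=k$ for every $j$. The space of Grushin type $\mathbb R^n\times\mathbb R^l$ with horizontal distribution spanned by $X_i=\partial/\partial x_i$ ($i=1,\dots,n$) and $Y_j=x^{\alpha^j}\,\partial/\partial y_j$ ($j=1,\dots,l$), equipped with its Carnot–Carathéodory distance, admits a bi-Lipschitz embedding into some Euclidean space.
   Context: Points of $\mathbb R^n\times\mathbb R^l$ are written $(x,y)$ with $x=(x_1,\dots,x_n)$, $y=(y_1,\dots,y_l)$; for a multi-index $\alpha$, $x^\alpha=x_1^{\alpha_1}\cdots x_n^{\alpha_n}$. The Carnot–Carathéodory distance between two points is the infimum of lengths $\int_0^1\big(\sum_i a_i(t)^2+\sum_j b_j(t)^2\big)^{1/2}dt$ over absolutely continuous curves $\gamma:[0,1]\to\mathbb R^n\times\mathbb R^l$ joining them with $\gamma'(t)=\sum_i a_i(t)X_i(\gamma(t))+\sum_j b_j(t)Y_j(\gamma(t))$ a.e. *)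

theory Defs
  imports "HOL-Analysis.Analysis"
begin

definition ac_curve_on :: "real \<Rightarrow> real \<Rightarrow> (real \<Rightarrow> 'a::real_normed_vector) \<Rightarrow> bool" where
  "ac_curve_on s t g \<longleftrightarrow>
     (\<forall>\<epsilon>>0. \<exists>\<delta>>0. \<forall>(m::nat) (u::nat \<Rightarrow> real) (v::nat \<Rightarrow> real).
        (\<forall>i<m. s \<le> u i \<and> u i \<le> v i \<and> v i \<le> t) \<and>
        (\<forall>i<m. \<forall>j<m. i \<noteq> j \<longrightarrow> v i \<le> u j \<or> v j \<le> u i) \<and>
        (\<Sum>i<m. v i - u i) < \<delta>
        \<longrightarrow> (\<Sum>i<m. norm (g (v i) - g (u i))) < \<epsilon>)"

definition monom_pow :: "real^'n::finite \<Rightarrow> ('n \<Rightarrow> nat) \<Rightarrow> real" where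
  "monom_pow x a = (\<Prod>i\<in>UNIV. (x $ i) ^ a i)"

text \<open>Horizontal field combination: sum_i a_i X_i + sum_j b_j Y_j at point p, with
  X_i = d/dx_i and Y_j = x^(alpha j) d/dy_j.\<close>
definition grushin_field ::
  "('l::finite \<Rightarrow> 'n::finite \<Rightarrow> nat) \<Rightarrow> (real^'n) \<times> (real^'l) \<Rightarrow> ('n \<Rightarrow> real) \<Rightarrow> ('l \<Rightarrow> real) \<Rightarrow> (real^'n) \<times> (real^'l)" where
  "grushin_field alpha p a b = ((\<chi> i. a i), (\<chi> j. monom_pow (fst p) (alpha j) * b j))"

definition grushin_admissible ::
  "('l::finite \<Rightarrow> 'n::finite \<Rightarrow> nat) \<Rightarrow> (real^'n) \<times> (real^'l) \<Rightarrow> (real^'n) \<times> (real^'l) \<Rightarrow>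
   (real \<Rightarrow> (real^'n) \<times> (real^'l)) \<Rightarrow> (real \<Rightarrow> 'n \<Rightarrow> real) \<Rightarrow> (real \<Rightarrow> 'l \<Rightarrow> real) \<Rightarrow> bool" where
  "grushin_admissible alpha p q g a b \<longleftrightarrow>
     g 0 = p \<and> g 1 = q \<and> ac_curve_on 0 1 g \<and>
     (AE t in lebesgue. t \<in> {0..1} \<longrightarrow>
        (g has_vector_derivative grushin_field alpha (g t) (a t) (b t)) (at t within {0..1}))"

definition control_length :: "(real \<Rightarrow> 'n::finite \<Rightarrow> real) \<Rightarrow> (real \<Rightarrow> 'l::finite \<Rightarrow> real) \<Rightarrow> ennreal" where
  "control_length a b =
     (\<integral>\<^sup>+ t\<in>{0..1}. ennreal (sqrt ((\<Sum>i\<in>UNIV. (a t i)\<^sup>2) + (\<Sum>j\<in>UNIV. (b t j)\<^sup>2))) \<partial>lebesgue)"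

text \<open>Carnot--Caratheodory distance (value in [0,\<infinity>]; \<infinity> if no admissible curve).\<close>
definition cc_dist ::
  "('l::finite \<Rightarrow> 'n::finite \<Rightarrow> nat) \<Rightarrow> (real^'n) \<times> (real^'l) \<Rightarrow> (real^'n) \<times> (real^'l) \<Rightarrow> ennreal" where
  "cc_dist alpha p q =
     (INF (g, a, b) \<in> {(g, a, b). grushin_admissible alpha p q g a b}. control_length a b)"

text \<open>Euclidean distance in R^N, points represented as functions nat \<Rightarrow> real
  (only the coordinates 0..N-1 matter).\<close>
definition eucl_dist :: "nat \<Rightarrow> (nat \<Rightarrow> real) \<Rightarrow> (nat \<Rightarrow> real) \<Rightarrow> real" where
  "eucl_dist N u v = sqrt (\<Sum>i<N. (u i - v i)\<^sup>2)"

definition bi_lipschitz_embeddable_in_euclidean ::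
  "('p \<Rightarrow> 'p \<Rightarrow> ennreal) \<Rightarrow> bool" where
  "bi_lipschitz_embeddable_in_euclidean d \<longleftrightarrow>
     (\<exists>(N::nat) (f::'p \<Rightarrow> nat \<Rightarrow> real) (C::real). C > 0 \<and>
        (\<forall>p q. ennreal (eucl_dist N (f p) (f q)) \<le> ennreal C * d p q \<and>
               d p q \<le> ennreal C * ennreal (eucl_dist N (f p) (f q))))"

end

theory Submission
  imports Defs
begin

text \<open>
  Write \<open>G\<^sub>j(x,r) = r \<Prod>\<^sub>i max(|x\<^sub>i|,r)^(\<alpha>\<^sup>j\<^sub>i)\<close>. A curve of length \<open>r\<close> starting over \<open>x\<close> moves \<open>y\<^sub>j\<close>
  by at most a constant times \<open>G\<^sub>j(x,r)\<close>, and a displacement \<open>G\<^sub>j(x,r)\<close> costs at most a constant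
  times \<open>r\<close>. Hence the distance of \<open>(x,y)\<close> and \<open>(x',y')\<close> is comparable to \<open>|x-x'| + \<Sum>\<^sub>j r\<^sub>j\<close> where
  \<open>G\<^sub>j(x,r\<^sub>j) = |y\<^sub>j-y'\<^sub>j|\<close>, and it suffices to embed each pair \<open>(x,y\<^sub>j)\<close> separately.

  For a single \<open>y\<close> the embedding is a lacunary series \<open>\<Sum>\<^sub>j A\<^sub>j(x) (exp(i L^j y) - 1)\<close> over the
  integers, as in Assouad's theorem. The amplitude \<open>A\<^sub>j(x)\<close> solves \<open>H(x,A\<^sub>j) = L^(-2j)\<close> with
  \<open>H = G\<^sup>2 max(\<mu>,r)/r\<close> and \<open>\<mu> = min |x\<^sub>i|\<close> over the exponents that occur. For \<open>r \<ge> \<mu>\<close> this is the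
  inverse function of \<open>G\<close>; for \<open>r < \<mu>\<close>, where \<open>G\<close> is linear in \<open>r\<close>, the factor \<open>max(\<mu>,r)/r\<close> makes
  the amplitudes small enough for the series to be Lipschitz in \<open>y\<close>. Because \<open>A\<^sub>j\<close> does not depend
  on \<open>x\<^sub>i\<close> once it exceeds \<open>|x\<^sub>i|\<close>, the sum of the variations of all \<open>A\<^sub>j\<close> is Lipschitz in \<open>x\<close>.
  Splitting the series by residue classes of \<open>j\<close> gives finitely many functions, one of which is
  dominated by a single term.
\<close>

section \<open>Absolutely continuous curves\<close>

lemma ac_curve_on_subinterval:
  assumes "ac_curve_on a b g" "a \<le> c" "d \<le> b"
  shows "ac_curve_on c d g"
  unfolding ac_curve_on_def
proof (intro allI impI)
  fix e :: real assume "e > 0"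
  then obtain \<delta> where \<delta>: "\<delta> > 0" "\<forall>(m::nat) (u::nat \<Rightarrow> real) (v::nat \<Rightarrow> real).
        (\<forall>i<m. a \<le> u i \<and> u i \<le> v i \<and> v i \<le> b) \<and>
        (\<forall>i<m. \<forall>j<m. i \<noteq> j \<longrightarrow> v i \<le> u j \<or> v j \<le> u i) \<and>
        (\<Sum>i<m. v i - u i) < \<delta>
        \<longrightarrow> (\<Sum>i<m. norm (g (v i) - g (u i))) < e"
    using assms(1) unfolding ac_curve_on_def by blast
  show "\<exists>\<delta>>0. \<forall>(m::nat) (u::nat \<Rightarrow> real) (v::nat \<Rightarrow> real).
        (\<forall>i<m. c \<le> u i \<and> u i \<le> v i \<and> v i \<le> d) \<and>
        (\<forall>i<m. \<forall>j<m. i \<noteq> j \<longrightarrow> v i \<le> u j \<or> v j \<le> u i) \<and>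
        (\<Sum>i<m. v i - u i) < \<delta>
        \<longrightarrow> (\<Sum>i<m. norm (g (v i) - g (u i))) < e"
  proof (intro exI conjI allI impI)
    show "\<delta> > 0" by fact
    fix m :: nat and u v :: "nat \<Rightarrow> real"
    assume *: "(\<forall>i<m. c \<le> u i \<and> u i \<le> v i \<and> v i \<le> d) \<and>
        (\<forall>i<m. \<forall>j<m. i \<noteq> j \<longrightarrow> v i \<le> u j \<or> v j \<le> u i) \<and> (\<Sum>i<m. v i - u i) < \<delta>"
    then have "\<forall>i<m. a \<le> u i \<and> u i \<le> v i \<and> v i \<le> b"
      using assms(2,3) by force
    with * \<delta>(2) show "(\<Sum>i<m. norm (g (v i) - g (u i))) < e"
      by blast
  qed
qed

lemma ac_curve_on_compose_lipschitz:
  fixes h :: "'a::real_normed_vector \<Rightarrow> 'b::real_normed_vector"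
  assumes g: "ac_curve_on a b g" and h: "\<And>x y. norm (h x - h y) \<le> B * norm (x - y)"
  shows "ac_curve_on a b (\<lambda>t. h (g t))"
  unfolding ac_curve_on_def
proof (intro allI impI)
  fix e :: real assume "e > 0"
  \<comment> \<open>The constant is raised to at least 1 so that \<open>e / B'\<close> is a positive
    tolerance for every sign of \<open>B\<close>.\<close>
  define B' where "B' = max B 1"
  have B': "B' > 0" and hB: "norm (h x - h y) \<le> B' * norm (x - y)" for x y
    using h[of x y] mult_right_mono[of B B' "norm (x - y)"] by (auto simp: B'_def)
  have "e / B' > 0"
    using \<open>e > 0\<close> B' by simp
  then obtain \<delta> where \<delta>: "\<delta> > 0" "\<forall>(m::nat) (u::nat \<Rightarrow> real) (v::nat \<Rightarrow> real).
        (\<forall>i<m. a \<le> u i \<and> u i \<le> v i \<and> v i \<le> b) \<and>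
        (\<forall>i<m. \<forall>j<m. i \<noteq> j \<longrightarrow> v i \<le> u j \<or> v j \<le> u i) \<and>
        (\<Sum>i<m. v i - u i) < \<delta>
        \<longrightarrow> (\<Sum>i<m. norm (g (v i) - g (u i))) < e / B'"
    using g unfolding ac_curve_on_def by blast
  show "\<exists>\<delta>>0. \<forall>(m::nat) (u::nat \<Rightarrow> real) (v::nat \<Rightarrow> real).
        (\<forall>i<m. a \<le> u i \<and> u i \<le> v i \<and> v i \<le> b) \<and>
        (\<forall>i<m. \<forall>j<m. i \<noteq> j \<longrightarrow> v i \<le> u j \<or> v j \<le> u i) \<and>
        (\<Sum>i<m. v i - u i) < \<delta>
        \<longrightarrow> (\<Sum>i<m. norm (h (g (v i)) - h (g (u i)))) < e"
  proof (intro exI conjI allI impI)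
    show "\<delta> > 0" by fact
    fix m :: nat and u v :: "nat \<Rightarrow> real"
    assume *: "(\<forall>i<m. a \<le> u i \<and> u i \<le> v i \<and> v i \<le> b) \<and>
        (\<forall>i<m. \<forall>j<m. i \<noteq> j \<longrightarrow> v i \<le> u j \<or> v j \<le> u i) \<and> (\<Sum>i<m. v i - u i) < \<delta>"
    have "(\<Sum>i<m. norm (h (g (v i)) - h (g (u i)))) \<le> B' * (\<Sum>i<m. norm (g (v i) - g (u i)))"
      unfolding sum_distrib_left by (intro sum_mono hB)
    also have "\<dots> < e"
      using \<delta>(2) * B' by (simp add: field_simps)
    finally show "(\<Sum>i<m. norm (h (g (v i)) - h (g (u i)))) < e" .
  qed
qed

text \<open>The identity curve is absolutely continuous with \<open>\<delta> = e\<close>, and a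
  Lipschitz \<open>g\<close> is a post-composition of it.\<close>

lemma lipschitz_imp_ac_curve_on:
  assumes "\<And>s t. norm (g s - g t) \<le> B * \<bar>s - t\<bar>"
  shows "ac_curve_on a b g"
proof -
  have "ac_curve_on a b (\<lambda>t::real. t)"
    unfolding ac_curve_on_def
  proof (intro allI impI)
    fix e :: real assume "e > 0"
    then show "\<exists>\<delta>>0. \<forall>(m::nat) (u::nat \<Rightarrow> real) (v::nat \<Rightarrow> real).
        (\<forall>i<m. a \<le> u i \<and> u i \<le> v i \<and> v i \<le> b) \<and>
        (\<forall>i<m. \<forall>j<m. i \<noteq> j \<longrightarrow> v i \<le> u j \<or> v j \<le> u i) \<and> (\<Sum>i<m. v i - u i) < \<delta>
        \<longrightarrow> (\<Sum>i<m. norm (v i - u i)) < e"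
      by (intro exI[of _ e]) auto
  qed
  from ac_curve_on_compose_lipschitz[OF this, of g B] show ?thesis
    using assms by simp
qed

text \<open>The tags lying in the exceptional null set are controlled by absolute continuity, the
  remaining ones as in the classical fundamental theorem.\<close>
lemma ac_curve_has_integral:
  fixes g :: "real \<Rightarrow> 'a::banach"
  assumes "a \<le> b" and ac: "ac_curve_on a b g" and S: "negligible S"
    and deriv: "\<And>t. t \<in> {a..b} - S \<Longrightarrow> (g has_vector_derivative g' t) (at t within {a..b})"
  shows "(g' has_integral (g b - g a)) {a..b}"
proof -
  \<comment> \<open>With the value 0 on \<open>S\<close>, an interval tagged in \<open>S\<close>
    contributes only the increment of \<open>g\<close> to the error.\<close>
  define f' where "f' = (\<lambda>t. if t \<in> S then 0 else g' t)"
  have "(f' has_integral (g b - g a)) (cbox a b)"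
    unfolding has_integral
  proof (intro allI impI)
    fix e :: real assume e: "e > 0"
    \<comment> \<open>Half of \<open>e\<close> is reserved for the tags in \<open>S\<close>; the
      summand 1 avoids division by zero when \<open>a = b\<close>.\<close>
    define e1 where "e1 = e / (2 * (b - a + 1))"
    have e1: "e1 > 0" using e \<open>a \<le> b\<close> by (simp add: e1_def)
    have "\<forall>x. \<exists>d>0. x \<in> {a..b} - S \<longrightarrow>
         (\<forall>y\<in>{a..b}. norm (y-x) < d \<longrightarrow> norm (g y - g x - (y-x) *\<^sub>R g' x) \<le> e1 * norm (y-x))"
    proof
      fix x
      show "\<exists>d>0. x \<in> {a..b} - S \<longrightarrow>
         (\<forall>y\<in>{a..b}. norm (y-x) < d \<longrightarrow> norm (g y - g x - (y-x) *\<^sub>R g' x) \<le> e1 * norm (y-x))"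
      proof (cases "x \<in> {a..b} - S")
        case True
        from deriv[OF this] e1 show ?thesis
          unfolding has_vector_derivative_def has_derivative_within_alt by blast
      qed (auto intro: exI[of _ 1])
    qed
    then obtain d where d: "\<And>x. 0 < d x"
                 "\<And>x y. \<lbrakk>x \<in> {a..b} - S; y \<in> {a..b}; norm (y-x) < d x\<rbrakk>
                        \<Longrightarrow> norm (g y - g x - (y-x) *\<^sub>R g' x) \<le> e1 * norm (y-x)"
      by metis
    obtain \<delta> where \<delta>: "\<delta> > 0" "\<And>(m::nat) (u::nat \<Rightarrow> real) (v::nat \<Rightarrow> real).
        (\<forall>i<m. a \<le> u i \<and> u i \<le> v i \<and> v i \<le> b) \<Longrightarrow>
        (\<forall>i<m. \<forall>j<m. i \<noteq> j \<longrightarrow> v i \<le> u j \<or> v j \<le> u i) \<Longrightarrow>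
        (\<Sum>i<m. v i - u i) < \<delta> \<Longrightarrow> (\<Sum>i<m. norm (g (v i) - g (u i))) < e / 2"
      using ac[unfolded ac_curve_on_def, rule_format, of "e / 2"] e by auto
    have Sl: "S \<in> sets lebesgue" "S \<in> null_sets lebesgue"
      using S negligible_iff_null_sets by blast+
    obtain U where U: "open U" "S \<subseteq> U" "U - S \<in> lmeasurable" "emeasure lebesgue (U - S) < ennreal \<delta>"
      using sets_lebesgue_outer_open[OF Sl(1) \<delta>(1)] by blast
    have U': "emeasure lebesgue U < ennreal \<delta>"
      using U(1,4) Sl(2) emeasure_Diff_null_set[of S lebesgue U] by simp
    then have Ulm: "U \<in> lmeasurable"
      using U(1) by (auto simp: fmeasurable_def intro: order_less_trans)
    have Um: "measure lebesgue U < \<delta>"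
      using U' Ulm \<delta>(1) by (metis emeasure_eq_measure2 ennreal_less_iff measure_nonneg)
    \<comment> \<open>Intervals tagged in \<open>S\<close> are confined to \<open>U\<close>, so
      their total length is below the \<open>\<delta>\<close> of absolute continuity. The other tags
      get the radius at which the derivative estimate holds.\<close>
    define \<gamma> where "\<gamma> = (\<lambda>x. if x \<in> S then U else ball x (d x))"
    have "gauge \<gamma>"
      using U(1,2) d(1) by (auto simp: gauge_def \<gamma>_def)
    moreover have "norm ((\<Sum>(x,K)\<in>p. measure lborel K *\<^sub>R f' x) - (g b - g a)) < e"
      if ptag: "p tagged_division_of cbox a b" and finep: "\<gamma> fine p" for p
    proof -
      have finp: "finite p" using ptag by blast
      have ba: "b - a = (\<Sum>(x,K)\<in>p. Sup K - Inf K)" "g b - g a = (\<Sum>(x,K)\<in>p. g(Sup K) - g(Inf K))"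
        using additive_tagged_division_1[where f= "\<lambda>x. x"] additive_tagged_division_1[where f= g]
              \<open>a \<le> b\<close> ptag by auto
      have box: "\<exists>u v. K = {u..v} \<and> u \<le> v \<and> a \<le> u \<and> v \<le> b \<and> Inf K = u \<and> Sup K = v \<and> x \<in> {u..v} \<and> K \<subseteq> \<gamma> x"
        if xK: "(x, K) \<in> p" for x K
      proof -
        obtain u v where K: "K = cbox u v" and x: "x \<in> K" and sub: "K \<subseteq> cbox a b"
          using ptag xK by (meson tagged_division_ofD(2-4))
        then have "u \<le> v" by auto
        with sub K have "a \<le> u" "v \<le> b" by auto
        then show ?thesis
          using K x \<open>u \<le> v\<close> finep xK by (auto simp: fine_def)
      qed
      \<comment> \<open>Degenerate intervals are left out: they contribute nothing, but they may sit
        inside another interval and would spoil the separation \<open>disj\<close>.\<close>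
      define q where "q = {(x,K)\<in>p. x \<in> S \<and> Inf K < Sup K}"
      have qp: "q \<subseteq> p" by (auto simp: q_def)
      then have finq: "finite q" using finp finite_subset by blast
      have disj: "Sup K \<le> Inf K' \<or> Sup K' \<le> Inf K" 
        if "(x,K) \<in> q" "(x',K') \<in> q" "(x,K) \<noteq> (x',K')" for x K x' K'
      proof (rule ccontr)
        assume neg: "\<not> ?thesis"
        have "(x,K) \<in> p" "(x',K') \<in> p" using that by (auto simp: q_def)
        then have "interior K \<inter> interior K' = {}"
          using tagged_division_ofD(5)[OF ptag] that(3) by blast
        moreover obtain u v where 1: "K = {u..v}" "Inf K = u" "Sup K = v" using box[OF \<open>(x,K) \<in> p\<close>] by blast
        moreover obtain u' v' where 2: "K' = {u'..v'}" "Inf K' = u'" "Sup K' = v'" using box[OF \<open>(x',K') \<in> p\<close>] by blast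
        moreover have "u < v" "u' < v'" using that 1 2 by (auto simp: q_def)
        moreover have "u' < v" "u < v'" using neg 1 2 by auto
        \<comment> \<open>The midpoint of the overlap would be interior to both intervals.\<close>
        ultimately have "(max u u' + min v v') / 2 \<in> interior K \<inter> interior K'"
          by (auto simp: interior_atLeastAtMost_real)
        then show False using \<open>interior K \<inter> interior K' = {}\<close> by blast
      qed
      \<comment> \<open>An enumeration of \<open>q\<close> brings the intervals into the indexed
        form that \<open>ac_curve_on\<close> requires.\<close>
      obtain h where h: "bij_betw h {..<card q} q"
        using ex_bij_betw_nat_finite[OF finq] by (auto simp: atLeast0LessThan)
      have hq: "h i \<in> q" if "i < card q" for i
        using h that by (auto simp: bij_betw_def)
      have hinj: "h i \<noteq> h j" if "i < card q" "j < card q" "i \<noteq> j" for i j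
        using h that by (auto simp: bij_betw_def inj_on_def)
      define u where "u i = Inf (snd (h i))" for i
      define v where "v i = Sup (snd (h i))" for i
      have uv: "a \<le> u i \<and> u i \<le> v i \<and> v i \<le> b \<and> {u i<..<v i} \<subseteq> U" if "i < card q" for i
      proof -
        have "(fst (h i), snd (h i)) \<in> p" "fst (h i) \<in> S" using hq[OF that] qp by (auto simp: q_def)
        from box[OF this(1)] this(2) show ?thesis
          by (fastforce simp: u_def v_def \<gamma>_def)
      qed
      have sep: "v i \<le> u j \<or> v j \<le> u i" if "i < card q" "j < card q" "i \<noteq> j" for i j
        using disj[of "fst (h i)" "snd (h i)" "fst (h j)" "snd (h j)"] hq that hinj[OF that]
        by (auto simp: u_def v_def)
      have "(\<Sum>i<card q. v i - u i) = (\<Sum>i<card q. measure lebesgue {u i<..<v i})"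
        using uv by (intro sum.cong) auto
      also have "\<dots> = measure lebesgue (\<Union>i<card q. {u i<..<v i})"
      proof (rule measure_finite_Union[symmetric])
        show "disjoint_family_on (\<lambda>i. {u i<..<v i}) {..<card q}"
          unfolding disjoint_family_on_def
        proof (intro ballI impI)
          fix i j assume "i \<in> {..<card q}" "j \<in> {..<card q}" "i \<noteq> j"
          then show "{u i<..<v i} \<inter> {u j<..<v j} = {}"
            using sep[of i j] by auto
        qed
      next
        fix i assume "i \<in> {..<card q}"
        then show "emeasure lebesgue {u i<..<v i} \<noteq> \<infinity>"
          using uv[of i] by auto
      qed auto
      also have "\<dots> \<le> measure lebesgue U"
        using uv Ulm by (intro measure_mono_fmeasurable) auto
      finally have "(\<Sum>i<card q. v i - u i) < \<delta>"
        using Um by (rule le_less_trans)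
      then have "(\<Sum>i<card q. norm (g (v i) - g (u i))) < e / 2"
        by (intro \<delta>(2)) (use uv sep in blast)+
      also have "(\<Sum>i<card q. norm (g (v i) - g (u i))) = (\<Sum>(x,K)\<in>q. norm (g (Sup K) - g (Inf K)))"
        using sum.reindex_bij_betw[OF h, of "\<lambda>(x,K). norm (g (Sup K) - g (Inf K))"]
        by (simp add: u_def v_def split_def)
      finally have sumq: "(\<Sum>(x,K)\<in>q. norm (g (Sup K) - g (Inf K))) < e / 2" .
      have est: "norm (measure lborel K *\<^sub>R f' x - (g (Sup K) - g (Inf K))) \<le> 
           (if (x,K) \<in> q then norm (g (Sup K) - g (Inf K)) else 0) + e1 * (Sup K - Inf K)"
        if xK: "(x,K) \<in> p" for x K
      proof -
        obtain u v where K: "K = {u..v}" and uv: "u \<le> v" "a \<le> u" "v \<le> b" "Inf K = u" "Sup K = v" "x \<in> {u..v}" "K \<subseteq> \<gamma> x"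
          using box[OF xK] by blast
        show ?thesis
        proof (cases "x \<in> S")
          case True
          then show ?thesis
            using uv e1 xK by (cases "u = v") (auto simp: f'_def q_def norm_minus_commute)
        next
          case False
          then have bl: "K \<subseteq> ball x (d x)" using uv by (simp add: \<gamma>_def)
          have "norm ((v - u) *\<^sub>R g' x - (g v - g u)) = norm (g u - g x - (u - x) *\<^sub>R g' x - (g v - g x - (v - x) *\<^sub>R g' x))"
            by (auto simp: algebra_simps)
          also have "\<dots> \<le> norm (g u - g x - (u - x) *\<^sub>R g' x) + norm (g v - g x - (v - x) *\<^sub>R g' x)"
            by (rule norm_triangle_ineq4)
          \<comment> \<open>The tag lies between the two ends of \<open>K\<close>, so the errors at
            the ends add up to \<open>e1\<close> times the length of \<open>K\<close>.\<close>
          also have "\<dots> \<le> e1 * norm (u - x) + e1 * norm (v - x)"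
          proof (rule add_mono)
            have "u \<in> K" "v \<in> K" using K uv(1) by auto
            then have "u \<in> ball x (d x)" "v \<in> ball x (d x)" using bl by blast+
            then have "norm (u - x) < d x" "norm (v - x) < d x"
              by (auto simp: dist_real_def)
            moreover have "x \<in> {a..b} - S" "u \<in> {a..b}" "v \<in> {a..b}"
              using uv(1-3,6) False by auto
            ultimately show "norm (g u - g x - (u - x) *\<^sub>R g' x) \<le> e1 * norm (u - x)"
              "norm (g v - g x - (v - x) *\<^sub>R g' x) \<le> e1 * norm (v - x)"
              using d(2)[of x u] d(2)[of x v] by simp_all
          qed
          also have "\<dots> = e1 * (v - u)"
            using uv by (auto simp: algebra_simps)
          finally show ?thesis
            using False uv K by (simp add: f'_def q_def)
        qed
      qed
      have "norm ((\<Sum>(x,K)\<in>p. measure lborel K *\<^sub>R f' x) - (g b - g a)) 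
          = norm (\<Sum>(x,K)\<in>p. measure lborel K *\<^sub>R f' x - (g (Sup K) - g (Inf K)))"
        by (simp add: ba split_def sum_subtractf)
      also have "\<dots> \<le> (\<Sum>(x,K)\<in>p. (if (x,K) \<in> q then norm (g (Sup K) - g (Inf K)) else 0) + e1 * (Sup K - Inf K))"
        using est by (intro sum_norm_le) auto
      also have "\<dots> = (\<Sum>y\<in>p. if y \<in> q then norm (g (Sup (snd y)) - g (Inf (snd y))) else 0) + e1 * (b - a)"
        by (simp add: ba split_def sum.distrib sum_distrib_left)
      also have "(\<Sum>y\<in>p. if y \<in> q then norm (g (Sup (snd y)) - g (Inf (snd y))) else 0) 
        = (\<Sum>(x,K)\<in>q. norm (g (Sup K) - g (Inf K)))"
        using qp finp by (simp add: sum.If_cases split_def Int_absorb1)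
      also have "\<dots> + e1 * (b - a) < e / 2 + e / 2"
      proof (rule add_less_le_mono[OF sumq])
        show "e1 * (b - a) \<le> e / 2"
          using \<open>a \<le> b\<close> e by (simp add: e1_def field_simps)
      qed
      finally show ?thesis by simp
    qed
    ultimately show "\<exists>\<gamma>. gauge \<gamma> \<and> (\<forall>\<D>. \<D> tagged_division_of cbox a b \<and> \<gamma> fine \<D> \<longrightarrow>
          norm ((\<Sum>(x, k)\<in>\<D>. measure lborel k *\<^sub>R f' x) - (g b - g a)) < e)"
      by (intro exI[of _ \<gamma>] conjI allI impI) simp_all
  qed
  then have "(f' has_integral (g b - g a)) {a..b}" by simp
  then show ?thesis
    by (rule has_integral_spike[OF S, rotated]) (simp add: f'_def)
qed

text \<open>The dominating function need not be measurable: \<open>nn_integral\<close> is then a lower integral.\<close>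
lemma ac_curve_norm_diff_le:
  fixes g :: "real \<Rightarrow> 'a::euclidean_space"
  assumes "a \<le> b" and ac: "ac_curve_on a b g"
    and deriv: "AE t in lebesgue. t \<in> {a..b} \<longrightarrow>
      (g has_vector_derivative g' t) (at t within {a..b}) \<and> norm (g' t) \<le> h t"
  shows "ennreal (norm (g b - g a)) \<le> (\<integral>\<^sup>+ t\<in>{a..b}. ennreal (h t) \<partial>lebesgue)"
proof (cases "(\<integral>\<^sup>+ t\<in>{a..b}. ennreal (h t) \<partial>lebesgue) = \<infinity>")
  case False
  obtain S where S: "S \<in> null_sets lebesgue" and
    dS: "\<And>t. t \<in> space lebesgue - S \<Longrightarrow> t \<in> {a..b} \<longrightarrow>
      (g has_vector_derivative g' t) (at t within {a..b}) \<and> norm (g' t) \<le> h t"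
    by (rule AE_E3[OF deriv]) blast
  have int: "(g' has_integral (g b - g a)) {a..b}"
  proof (rule ac_curve_has_integral[OF assms(1,2)])
    show "negligible S"
      using S by (simp add: negligible_iff_null_sets)
    show "(g has_vector_derivative g' t) (at t within {a..b})" if "t \<in> {a..b} - S" for t
      using dS[of t] that by simp
  qed
  define F where "F = (\<lambda>t. indicator {a..b} t *\<^sub>R g' t)"
  have meas: "F \<in> borel_measurable lebesgue"
    using has_integral_implies_lebesgue_measurable[OF int] by (simp add: F_def)
  have le: "(\<integral>\<^sup>+ t. ennreal (norm (F t)) \<partial>lebesgue) \<le> (\<integral>\<^sup>+ t\<in>{a..b}. ennreal (h t) \<partial>lebesgue)"
  proof (rule nn_integral_mono_AE)
    show "AE t in lebesgue. ennreal (norm (F t)) \<le> ennreal (h t) * indicator {a..b} t"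
      using deriv
    proof (rule eventually_mono)
      fix t assume "t \<in> {a..b} \<longrightarrow>
        (g has_vector_derivative g' t) (at t within {a..b}) \<and> norm (g' t) \<le> h t"
      then show "ennreal (norm (F t)) \<le> ennreal (h t) * indicator {a..b} t"
        by (cases "t \<in> {a..b}") (auto simp: F_def intro: ennreal_leI)
    qed
  qed
  \<comment> \<open>Finiteness of the dominating integral makes \<open>F\<close> Lebesgue
    integrable; uniqueness of the gauge integral then identifies its value as
    \<open>g b - g a\<close>.\<close>
  have integrable: "integrable lebesgue F"
    using meas le False by (intro integrableI_bounded) (auto simp: top.not_eq_extremum intro: le_less_trans)
  then have "(F has_integral (integral\<^sup>L lebesgue F)) UNIV"
    by (rule has_integral_integral_lebesgue)
  moreover have "F = (\<lambda>t. if t \<in> {a..b} then g' t else 0)"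
    by (auto simp: F_def)
  then have "(F has_integral (g b - g a)) UNIV"
    using int by (simp only: has_integral_restrict_UNIV)
  ultimately have "g b - g a = integral\<^sup>L lebesgue F"
    by (rule has_integral_unique[symmetric])
  then have "ennreal (norm (g b - g a)) \<le> (\<integral>\<^sup>+ t. ennreal (norm (F t)) \<partial>lebesgue)"
    using integral_norm_bound_ennreal[OF integrable] by simp
  then show ?thesis using le by (rule order_trans)
next
  case True
  show ?thesis unfolding True infinity_ennreal_def by (rule top_greatest)
qed

section \<open>The reach weight and its inverse\<close>

lemma sum_half_powers_le:
  fixes N :: "nat set"
  assumes "finite N" and "\<And>n. n \<in> N \<Longrightarrow> M \<le> n"
  shows "(\<Sum>n\<in>N. (1/2::real) ^ n) \<le> 2 * (1/2) ^ M"
proof -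
  have *: "(\<Sum>n = M..<M + k. (1/2::real) ^ n) = 2 * (1/2) ^ M - 2 * (1/2) ^ (M + k)" for k
    by (induction k) (auto simp: power_add)
  obtain k where "N \<subseteq> {M..<M + k}"
  proof
    show "N \<subseteq> {M..<M + (Suc (Max N))}"
      using assms by (auto simp: less_Suc_eq_le intro!: trans_le_add2 Max_ge)
  qed
  then have "(\<Sum>n\<in>N. (1/2::real) ^ n) \<le> (\<Sum>n = M..<M + k. (1/2::real) ^ n)"
    by (intro sum_mono2) auto
  also have "\<dots> \<le> 2 * (1/2) ^ M"
    by (simp add: *)
  finally show ?thesis .
qed

lemma sum_half_powers_int_le:
  fixes J :: "int set"
  assumes "finite J" and "\<And>j. j \<in> J \<Longrightarrow> int M \<le> \<bar>j - m\<bar>"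
  shows "(\<Sum>j\<in>J. (1/2::real) ^ nat \<bar>j - m\<bar>) \<le> 4 * (1/2) ^ M"
proof -
  have half: "(\<Sum>j\<in>{j\<in>J. P j}. (1/2::real) ^ nat \<bar>j - m\<bar>) \<le> 2 * (1/2) ^ M"
    if "inj_on (\<lambda>j. nat \<bar>j - m\<bar>) {j\<in>J. P j}" for P
  proof -
    have "(\<Sum>j\<in>{j\<in>J. P j}. (1/2::real) ^ nat \<bar>j - m\<bar>)
        = (\<Sum>n\<in>(\<lambda>j. nat \<bar>j - m\<bar>) ` {j\<in>J. P j}. (1/2) ^ n)"
      using that by (simp add: sum.reindex)
    also have "\<dots> \<le> 2 * (1/2) ^ M"
      by (rule sum_half_powers_le) (use assms in force)+
    finally show ?thesis .
  qed
  have "(\<Sum>j\<in>J. (1/2::real) ^ nat \<bar>j - m\<bar>)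
      = (\<Sum>j\<in>{j\<in>J. m \<le> j}. (1/2::real) ^ nat \<bar>j - m\<bar>) + (\<Sum>j\<in>{j\<in>J. j < m}. (1/2::real) ^ nat \<bar>j - m\<bar>)"
    using assms(1) by (subst sum.union_disjoint[symmetric]) (auto intro: sum.cong)
  also have "\<dots> \<le> 2 * (1/2) ^ M + 2 * (1/2) ^ M"
    by (intro add_mono half) (auto simp: inj_on_def)
  finally show ?thesis by simp
qed

text \<open>The smallest index of \<open>J\<close> carries a term of size at most \<open>Z\<close>,
  and all later terms decay geometrically from it. This turns a bound on each scale into a bound on
  the sum of all scales below a given coordinate.\<close>

lemma sum_geometric_decay_le:
  fixes f :: "int \<Rightarrow> real"
  assumes "finite J" and nonneg: "\<And>j. 0 \<le> f j" and decay: "\<And>j. f (j + 1) \<le> f j / 2"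
    and bound: "\<And>j. j \<in> J \<Longrightarrow> f j \<le> Z" and "0 \<le> Z"
  shows "sum f J \<le> 4 * Z"
proof (cases "J = {}")
  case False
  define m where "m = Min J"
  have m: "m \<in> J" "\<And>j. j \<in> J \<Longrightarrow> m \<le> j"
    using False assms(1) by (auto simp: m_def)
  have pow: "f (m + int n) \<le> f m * (1/2) ^ n" for n
  proof (induction n)
    case (Suc n)
    have "f (m + int (Suc n)) \<le> f (m + int n) / 2"
      using decay[of "m + int n"] by (simp add: algebra_simps)
    also have "\<dots> \<le> f m * (1/2) ^ Suc n"
      using Suc by simp
    finally show ?case .
  qed simp
  have "f j \<le> Z * (1/2) ^ nat \<bar>j - m\<bar>" if "j \<in> J" for j
  proof -
    have "f j \<le> f m * (1/2) ^ nat \<bar>j - m\<bar>"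
      using pow[of "nat (j - m)"] m(2)[OF that] by simp
    also have "\<dots> \<le> Z * (1/2) ^ nat \<bar>j - m\<bar>"
      using bound[OF m(1)] by (intro mult_right_mono) auto
    finally show ?thesis .
  qed
  then have "sum f J \<le> Z * (\<Sum>j\<in>J. (1/2) ^ nat \<bar>j - m\<bar>)"
    by (simp add: sum_distrib_left sum_mono)
  also have "\<dots> \<le> Z * 4"
    using sum_half_powers_int_le[OF assms(1), of 0 m] \<open>0 \<le> Z\<close> by (intro mult_left_mono) auto
  finally show ?thesis by simp
qed (use assms in simp)

text \<open>This is the function \<open>G\<close> of the overview when \<open>z i\<close> is the
  absolute value of the i-th coordinate. The index type and \<open>z\<close> are arbitrary because
  the function \<open>H\<close> is an instance as well, with one additional coordinate.\<close>

definition reach_weight :: "('i::finite \<Rightarrow> nat) \<Rightarrow> ('i \<Rightarrow> real) \<Rightarrow> real \<Rightarrow> real" where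
  "reach_weight \<beta> z r = r * (\<Prod>i\<in>UNIV. max (z i) r ^ \<beta> i)"

lemma reach_weight_nonneg: "0 \<le> r \<Longrightarrow> 0 \<le> reach_weight \<beta> z r"
  by (auto simp: reach_weight_def intro!: mult_nonneg_nonneg prod_nonneg zero_le_power)

lemma reach_weight_pos: "0 < r \<Longrightarrow> 0 < reach_weight \<beta> z r"
  by (auto simp: reach_weight_def intro!: mult_pos_pos prod_pos zero_less_power)

lemma reach_weight_zero [simp]: "reach_weight \<beta> z 0 = 0"
  by (simp add: reach_weight_def)

text \<open>The leading factor \<open>r\<close> scales exactly and the maxima can only grow. The
  reverse bound \<open>reach_weight_scale_le\<close> comes from each of the
  \<open>Suc (sum \<beta> UNIV)\<close> factors growing by at most \<open>c\<close>.\<close>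

lemma reach_weight_scale_ge:
  assumes "1 \<le> c" "0 \<le> r"
  shows "c * reach_weight \<beta> z r \<le> reach_weight \<beta> z (c * r)"
proof -
  have "r \<le> c * r"
    using assms mult_right_mono[of 1 c r] by simp
  then have "(\<Prod>i\<in>UNIV. max (z i) r ^ \<beta> i) \<le> (\<Prod>i\<in>UNIV. max (z i) (c * r) ^ \<beta> i)"
    using assms by (intro prod_mono) (auto intro!: power_mono zero_le_power)
  then show ?thesis
    using assms by (auto simp: reach_weight_def mult.assoc intro!: mult_left_mono)
qed

lemma reach_weight_strict_mono:
  assumes "0 \<le> r" "r < s"
  shows "reach_weight \<beta> z r < reach_weight \<beta> z s"
proof (cases "r = 0")
  case False
  then have "r > 0" using assms by simp
  then have "reach_weight \<beta> z r < (s / r) * reach_weight \<beta> z r"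
    using assms reach_weight_pos[of r \<beta> z] by (simp add: field_simps)
  also have "\<dots> \<le> reach_weight \<beta> z s"
    using reach_weight_scale_ge[of "s / r" r \<beta> z] assms \<open>r > 0\<close> by simp
  finally show ?thesis .
qed (use assms reach_weight_pos[of s \<beta> z] in simp)

lemma reach_weight_le_iff:
  assumes "0 \<le> r" "0 \<le> s"
  shows "reach_weight \<beta> z r \<le> reach_weight \<beta> z s \<longleftrightarrow> r \<le> s"
  using reach_weight_strict_mono[of r s \<beta> z] reach_weight_strict_mono[of s r \<beta> z] assms
  by (cases r s rule: linorder_cases) auto

lemma reach_weight_scale_le:
  assumes "1 \<le> c" "0 \<le> r"
  shows "reach_weight \<beta> z (c * r) \<le> c ^ Suc (sum \<beta> UNIV) * reach_weight \<beta> z r"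
proof -
  have "max (z i) (c * r) ^ \<beta> i \<le> (c * max (z i) r) ^ \<beta> i" for i
  proof (intro power_mono)
    have "z i \<le> max (z i) r" by simp
    also have "\<dots> \<le> c * max (z i) r"
      using assms mult_right_mono[of 1 c "max (z i) r"] by simp
    finally have "z i \<le> c * max (z i) r" .
    moreover have "c * r \<le> c * max (z i) r"
      using assms by (intro mult_left_mono) auto
    ultimately show "max (z i) (c * r) \<le> c * max (z i) r" by simp
  qed (use assms in \<open>auto simp: le_max_iff_disj\<close>)
  then have "(\<Prod>i\<in>UNIV. max (z i) (c * r) ^ \<beta> i) \<le> (\<Prod>i\<in>UNIV. (c * max (z i) r) ^ \<beta> i)"
    using assms by (intro prod_mono) (auto intro!: zero_le_power simp: le_max_iff_disj)
  also have "\<dots> = c ^ sum \<beta> UNIV * (\<Prod>i\<in>UNIV. max (z i) r ^ \<beta> i)"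
    by (simp add: power_mult_distrib prod.distrib power_sum)
  finally show ?thesis
    using assms mult_left_mono[of "\<Prod>i\<in>UNIV. max (z i) (c * r) ^ \<beta> i"
        "c ^ sum \<beta> UNIV * (\<Prod>i\<in>UNIV. max (z i) r ^ \<beta> i)" "c * r"]
    by (simp add: reach_weight_def mult_ac)
qed

lemma ex_reach_weight_eq:
  assumes "0 \<le> t"
  shows "\<exists>r\<ge>0. reach_weight \<beta> z r = t"
proof -
  \<comment> \<open>From \<open>T \<ge> 1\<close> every maximum is at least 1, so the weight at
    \<open>T\<close> is at least \<open>T\<close>, and the intermediate value theorem
    applies.\<close>
  define T where "T = max 1 t"
  have "1 \<le> (\<Prod>i\<in>UNIV. max (z i) T ^ \<beta> i)"
    by (intro prod_ge_1 one_le_power) (auto simp: T_def)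
  then have "T * 1 \<le> reach_weight \<beta> z T"
    unfolding reach_weight_def by (intro mult_left_mono) (auto simp: T_def)
  then have "t \<le> reach_weight \<beta> z T"
    by (simp add: T_def)
  moreover have "continuous_on {0..T} (reach_weight \<beta> z)"
    unfolding reach_weight_def by (intro continuous_intros)
  ultimately show ?thesis
    using IVT'[of "reach_weight \<beta> z" 0 t T] assms by (auto simp: T_def le_max_iff_disj)
qed

text \<open>The inverse function of the weight. For \<open>t \<le> 0\<close> no positive solution
  exists and the value is unspecified.\<close>

definition reach_scale :: "('i::finite \<Rightarrow> nat) \<Rightarrow> ('i \<Rightarrow> real) \<Rightarrow> real \<Rightarrow> real" where
  "reach_scale \<beta> z t = (THE r. 0 < r \<and> reach_weight \<beta> z r = t)"

lemma reach_scale_unique: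
  assumes "0 < r" "reach_weight \<beta> z r = t"
  shows "reach_scale \<beta> z t = r"
  unfolding reach_scale_def
proof (rule the_equality)
  fix s assume "0 < s \<and> reach_weight \<beta> z s = t"
  then have "s \<le> r" "r \<le> s"
    using assms reach_weight_le_iff[of s r \<beta> z] reach_weight_le_iff[of r s \<beta> z] by simp_all
  then show "s = r" by simp
qed (use assms in auto)

lemma reach_scale:
  assumes "0 < t"
  shows reach_scale_pos: "0 < reach_scale \<beta> z t"
    and reach_weight_reach_scale: "reach_weight \<beta> z (reach_scale \<beta> z t) = t"
proof -
  obtain r where r: "r \<ge> 0" "reach_weight \<beta> z r = t"
    using ex_reach_weight_eq[of t \<beta> z] assms by auto
  with assms have "r \<noteq> 0" by auto
  with r have "0 < r" by simp
  with r show "0 < reach_scale \<beta> z t" "reach_weight \<beta> z (reach_scale \<beta> z t) = t"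
    using reach_scale_unique[of r \<beta> z t] by auto
qed

lemma reach_scale_le_iff:
  assumes "0 < t" "0 \<le> r"
  shows "reach_scale \<beta> z t \<le> r \<longleftrightarrow> t \<le> reach_weight \<beta> z r"
  using reach_weight_le_iff[of "reach_scale \<beta> z t" r \<beta> z] reach_scale[OF assms(1), of \<beta> z] assms by simp

lemma le_reach_scale_iff:
  assumes "0 < t" "0 \<le> r"
  shows "r \<le> reach_scale \<beta> z t \<longleftrightarrow> reach_weight \<beta> z r \<le> t"
  using reach_weight_le_iff[of r "reach_scale \<beta> z t" \<beta> z] reach_scale[OF assms(1), of \<beta> z] assms by simp

text \<open>The two scaling bounds of the weight pass to its inverse with their roles
  exchanged.\<close>

lemma reach_scale_mult_ge:
  assumes "0 < t" "1 \<le> c"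
  shows "c * reach_scale \<beta> z t \<le> reach_scale \<beta> z (c ^ Suc (sum \<beta> UNIV) * t)"
  using reach_weight_scale_le[of c "reach_scale \<beta> z t" \<beta> z] reach_scale[OF assms(1), of \<beta> z] assms
  by (subst le_reach_scale_iff) (auto intro!: mult_pos_pos)

lemma reach_scale_mult_le:
  assumes "0 < t" "1 \<le> c"
  shows "reach_scale \<beta> z (c * t) \<le> c * reach_scale \<beta> z t"
  using reach_weight_scale_ge[of c "reach_scale \<beta> z t" \<beta> z] reach_scale[OF assms(1), of \<beta> z] assms
  by (subst reach_scale_le_iff) auto

text \<open>Bernoulli's inequality bounds the relative change of the scale by that of the \<open>i\<close>-th
  coordinate; scales that exceed this coordinate do not feel it at all.\<close>
lemma reach_scale_upd_diff:
  fixes z :: "'i::finite \<Rightarrow> real" and \<beta> :: "'i \<Rightarrow> nat"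
  assumes t: "0 < t" and w: "0 \<le> w" "w \<le> z i"
  defines "r \<equiv> reach_scale \<beta> z t" and "r' \<equiv> reach_scale \<beta> (z(i := w)) t"
  shows "r = r' \<or> (r' \<le> z i \<and> r \<le> r' \<and> r' - r \<le> real (\<beta> i) * (z i - w) * r' / z i)"
proof (cases "z i \<le> r")
  case True
  have r: "0 < r" "reach_weight \<beta> z r = t"
    using reach_scale[OF t] by (auto simp: r_def)
  have "max ((z(i := w)) j) r = max (z j) r" for j
    using True w by (auto simp: max_def)
  then have "reach_weight \<beta> (z(i := w)) r = t"
    using r(2) by (simp add: reach_weight_def)
  then show ?thesis
    using reach_scale_unique[OF r(1), of \<beta> "z(i := w)" t] by (simp add: r'_def)
next
  case False
  let ?z' = "z(i := w)"
  have r: "0 < r" "reach_weight \<beta> z r = t" and r': "0 < r'" "reach_weight \<beta> ?z' r' = t"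
    using reach_scale[OF t] by (auto simp: r_def r'_def)
  have "max (?z' j) (z i) = max (z j) (z i)" for j
    using w by auto
  then have "reach_weight \<beta> ?z' (z i) = reach_weight \<beta> z (z i)"
    by (simp add: reach_weight_def)
  also have "\<dots> \<ge> t"
    using r False reach_weight_le_iff[of r "z i" \<beta> z] by auto
  finally have 1: "r' \<le> z i"
    using r' False r reach_weight_le_iff[of r' "z i" \<beta> ?z'] by auto
  have "reach_weight \<beta> ?z' r \<le> reach_weight \<beta> z r"
    unfolding reach_weight_def using w r(1)
    by (intro mult_left_mono prod_mono) (auto intro!: power_mono zero_le_power)
  then have 2: "r \<le> r'"
    using r r' reach_weight_le_iff[of r r' \<beta> ?z'] by auto
  \<comment> \<open>\<open>P\<close> collects the factors that are not affected by the change of the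
    i-th coordinate.\<close>
  define P where "P s = (\<Prod>j\<in>-{i}. max (z j) s ^ \<beta> j)" for s
  have U: "(UNIV :: 'i set) = insert i (-{i})" by auto
  have "t = r * (z i ^ \<beta> i * P r)"
    using r(2) False unfolding reach_weight_def by (subst (asm) U) (simp add: P_def)
  have "t = r' * (max w r' ^ \<beta> i * P r')"
  proof -
    have "(\<Prod>j\<in>-{i}. max (?z' j) r' ^ \<beta> j) = P r'"
      unfolding P_def by (intro prod.cong) auto
    then show ?thesis
      using r'(2) unfolding reach_weight_def by (subst (asm) U) simp
  qed
  \<comment> \<open>Both weights equal \<open>t\<close>, and \<open>P\<close> is monotone.
    Cancelling \<open>P r\<close> leaves an inequality in the i-th coordinate alone, to which
    Bernoulli applies at \<open>w / z i - 1\<close>.\<close>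
  have "r' * (w ^ \<beta> i * P r) \<le> r' * (max w r' ^ \<beta> i * P r')"
  proof (rule mult_left_mono[OF mult_mono])
    show "P r \<le> P r'"
      unfolding P_def using r(1) 2 by (intro prod_mono) (auto intro!: power_mono)
    show "w ^ \<beta> i \<le> max w r' ^ \<beta> i"
      using w by (intro power_mono) auto
    show "0 \<le> P r"
      unfolding P_def using r(1) by (intro prod_nonneg) auto
  qed (use r' w in auto)
  also have "\<dots> = r * (z i ^ \<beta> i * P r)"
    using \<open>t = r * _\<close> \<open>t = r' * _\<close> by simp
  finally have "(r' * w ^ \<beta> i) * P r \<le> (r * z i ^ \<beta> i) * P r"
    by (simp add: mult_ac)
  moreover have "P r > 0"
    using r(1) by (auto simp: P_def intro!: prod_pos zero_less_power)
  ultimately have "r' * w ^ \<beta> i \<le> r * z i ^ \<beta> i"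
    by (rule mult_right_le_imp_le)
  moreover have zi: "z i > 0" using False r by simp
  ultimately have "r' * (w / z i) ^ \<beta> i \<le> r"
    by (simp add: power_divide field_simps)
  moreover have "1 + real (\<beta> i) * (w / z i - 1) \<le> (w / z i) ^ \<beta> i"
    using Bernoulli_inequality[of "w / z i - 1" "\<beta> i"] w zi by simp
  ultimately have "r' * (1 + real (\<beta> i) * (w / z i - 1)) \<le> r"
    using r'(1) mult_left_mono[of "1 + real (\<beta> i) * (w / z i - 1)" "(w / z i) ^ \<beta> i" r'] by linarith
  then have "r' - r \<le> real (\<beta> i) * (z i - w) * r' / z i"
    using zi by (simp add: field_simps)
  with 1 2 show ?thesis by simp
qed

text \<open>Only indices whose changed scale is at most \<open>z i\<close> contribute, and each
  contributes a multiple of that scale divided by \<open>z i\<close>. By geometric decay these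
  scales sum to at most \<open>4 * z i\<close>, so \<open>z i\<close> cancels and the total
  variation is Lipschitz in the coordinate.\<close>

lemma reach_scale_upd_sum:
  fixes z :: "'i::finite \<Rightarrow> real" and T :: "int \<Rightarrow> real"
  assumes T: "\<And>j. 0 < T j" and decay: "\<And>z j. reach_scale \<beta> z (T (j + 1)) \<le> reach_scale \<beta> z (T j) / 2"
    and w: "0 \<le> w" "0 \<le> z i" and "finite J"
  shows "(\<Sum>j\<in>J. \<bar>reach_scale \<beta> z (T j) - reach_scale \<beta> (z(i := w)) (T j)\<bar>) \<le> 4 * real (\<beta> i) * \<bar>z i - w\<bar>"
proof -
  have main: "(\<Sum>j\<in>J. \<bar>reach_scale \<beta> z (T j) - reach_scale \<beta> (z(i := w)) (T j)\<bar>) \<le> 4 * real (\<beta> i) * (z i - w)"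
    if "0 \<le> w" "w \<le> z i" for z w
  proof (cases "z i = w")
    case False
    let ?r = "\<lambda>j. reach_scale \<beta> z (T j)" and ?r' = "\<lambda>j. reach_scale \<beta> (z(i := w)) (T j)"
    have zi: "0 < z i" using that False by simp
    let ?J = "{j\<in>J. ?r' j \<le> z i}"
    have zero: "?r j = ?r' j" if "j \<in> J - ?J" for j
      using reach_scale_upd_diff[of "T j" w z i \<beta>] T \<open>0 \<le> w\<close> \<open>w \<le> z i\<close> that by blast
    have "(\<Sum>j\<in>J. \<bar>?r j - ?r' j\<bar>) = (\<Sum>j\<in>?J. \<bar>?r j - ?r' j\<bar>)"
      using \<open>finite J\<close> zero by (intro sum.mono_neutral_right) auto
    also have "\<dots> \<le> (\<Sum>j\<in>?J. real (\<beta> i) * (z i - w) / z i * ?r' j)"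
    proof (rule sum_mono)
      fix j
      have "0 \<le> real (\<beta> i) * (z i - w) / z i * ?r' j"
        using that zi reach_scale_pos[OF T[of j], of \<beta> "z(i := w)"] by simp
      then show "\<bar>?r j - ?r' j\<bar> \<le> real (\<beta> i) * (z i - w) / z i * ?r' j"
        using reach_scale_upd_diff[of "T j" w z i \<beta>] T that by auto
    qed
    also have "\<dots> = real (\<beta> i) * (z i - w) / z i * (\<Sum>j\<in>?J. ?r' j)"
      by (simp add: sum_distrib_left)
    also have "\<dots> \<le> real (\<beta> i) * (z i - w) / z i * (4 * z i)"
    proof (rule mult_left_mono)
      show "(\<Sum>j\<in>?J. ?r' j) \<le> 4 * z i"
      proof (rule sum_geometric_decay_le)
        show "?r' (j + 1) \<le> ?r' j / 2" for j
          by (rule decay)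
        show "0 \<le> ?r' j" for j
          using reach_scale_pos[OF T[of j], of \<beta> "z(i := w)"] by simp
      qed (use \<open>finite J\<close> zi in auto)
    qed (use that zi in auto)
    also have "\<dots> = 4 * real (\<beta> i) * (z i - w)"
      using zi by simp
    finally show ?thesis .
  qed (use fun_upd_triv[of z i] in simp)
  show ?thesis
  proof (cases "w \<le> z i")
    case True
    then show ?thesis using main[of w z] w by simp
  next
    case False
    \<comment> \<open>If the coordinate is raised, the estimate is applied to the reverse change
      from \<open>w\<close> back to \<open>z i\<close>.\<close>
    have upd: "(z(i := w))(i := z i) = z" "(z(i := w)) i = w" by simp_all
    have "(\<Sum>j\<in>J. \<bar>reach_scale \<beta> (z(i := w)) (T j) - reach_scale \<beta> z (T j)\<bar>)
        \<le> 4 * real (\<beta> i) * (w - z i)"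
      using main[of "z i" "z(i := w)", unfolded upd] w(2) False by linarith
    moreover have "\<bar>z i - w\<bar> = w - z i"
      using False by linarith
    ultimately show ?thesis
      by (simp only: abs_minus_commute[of "reach_scale \<beta> z _"])
  qed
qed

text \<open>The coordinates are replaced one after another, and the variations add up by the
  triangle inequality.\<close>

lemma reach_scale_sum_lipschitz:
  fixes z z' :: "'i::finite \<Rightarrow> real" and T :: "int \<Rightarrow> real"
  assumes T: "\<And>j. 0 < T j" and decay: "\<And>z j. reach_scale \<beta> z (T (j + 1)) \<le> reach_scale \<beta> z (T j) / 2"
    and "\<And>i. 0 \<le> z i" "\<And>i. 0 \<le> z' i" and J: "finite J"
  shows "(\<Sum>j\<in>J. \<bar>reach_scale \<beta> z (T j) - reach_scale \<beta> z' (T j)\<bar>)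
    \<le> (\<Sum>i\<in>UNIV. 4 * real (\<beta> i) * \<bar>z i - z' i\<bar>)"
proof -
  have "(\<Sum>j\<in>J. \<bar>reach_scale \<beta> z (T j) - reach_scale \<beta> z' (T j)\<bar>)
    \<le> (\<Sum>i\<in>S. 4 * real (\<beta> i) * \<bar>z i - z' i\<bar>)"
    if "finite S" "\<forall>i. 0 \<le> z i" "\<forall>i. i \<notin> S \<longrightarrow> z i = z' i" for S z
    using that
  proof (induction S arbitrary: z rule: finite_induct)
    case empty
    then have "z = z'" by auto
    then show ?case by simp
  next
    case (insert i S)
    let ?y = "z(i := z' i)"
    let ?D = "\<lambda>z z'. \<Sum>j\<in>J. \<bar>reach_scale \<beta> z (T j) - reach_scale \<beta> z' (T j)\<bar>"
    have "?D z z' \<le> ?D z ?y + ?D ?y z'"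
      unfolding sum.distrib[symmetric] by (intro sum_mono) auto
    moreover have "?D z ?y \<le> 4 * real (\<beta> i) * \<bar>z i - z' i\<bar>"
      by (rule reach_scale_upd_sum[where \<beta> = \<beta> and T = T and z = z and i = i and w = "z' i"])
        (use insert.prems(1) T decay J assms(4) in simp_all)
    moreover have "?D ?y z' \<le> (\<Sum>k\<in>S. 4 * real (\<beta> k) * \<bar>?y k - z' k\<bar>)"
      by (rule insert.IH) (use insert.prems assms(4) in auto)
    moreover have "(\<Sum>k\<in>S. 4 * real (\<beta> k) * \<bar>?y k - z' k\<bar>) = (\<Sum>k\<in>S. 4 * real (\<beta> k) * \<bar>z k - z' k\<bar>)"
      using insert.hyps by (intro sum.cong) auto
    ultimately show ?case
      using insert.hyps by simp
  qed
  from this[of UNIV z] show ?thesis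
    using assms by simp
qed

section \<open>Amplitudes\<close>

text \<open>Coordinates with exponent 0 are ignored. If all exponents vanish, \<open>Min\<close> is
  taken of the empty set; hence the assumption of a positive exponent from here on.\<close>

definition min_coord :: "('n::finite \<Rightarrow> nat) \<Rightarrow> real^'n \<Rightarrow> real" where
  "min_coord \<alpha> x = Min ((\<lambda>i. \<bar>x $ i\<bar>) ` {i. 0 < \<alpha> i})"

lemma min_coord_le: "0 < \<alpha> i \<Longrightarrow> min_coord \<alpha> x \<le> \<bar>x $ i\<bar>"
  by (auto simp: min_coord_def intro!: Min_le)

lemma min_coord_attained:
  assumes "\<exists>i. 0 < \<alpha> i"
  obtains i where "0 < \<alpha> i" "min_coord \<alpha> x = \<bar>x $ i\<bar>"
proof -
  have "min_coord \<alpha> x \<in> (\<lambda>i. \<bar>x $ i\<bar>) ` {i. 0 < \<alpha> i}"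
    unfolding min_coord_def using assms by (intro Min_in) auto
  then show ?thesis using that by auto
qed

lemma min_coord_nonneg: "\<exists>i. 0 < \<alpha> i \<Longrightarrow> 0 \<le> min_coord \<alpha> x"
  using min_coord_attained[of \<alpha> x] by (metis abs_ge_zero)

lemma min_coord_lipschitz:
  assumes "\<exists>i. 0 < \<alpha> i"
  shows "\<bar>min_coord \<alpha> x - min_coord \<alpha> x'\<bar> \<le> norm (x - x')"
proof -
  have *: "min_coord \<alpha> x - min_coord \<alpha> x' \<le> norm (x - x')" for x x'
  proof -
    \<comment> \<open>Both minima are compared at the coordinate where the one of \<open>x'\<close>
      is attained.\<close>
    obtain i where i: "0 < \<alpha> i" "min_coord \<alpha> x' = \<bar>x' $ i\<bar>"
      using min_coord_attained[OF assms] by blast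
    have "min_coord \<alpha> x - min_coord \<alpha> x' \<le> \<bar>x $ i\<bar> - \<bar>x' $ i\<bar>"
      using min_coord_le[of \<alpha> i x] i by simp
    also have "\<dots> \<le> \<bar>(x - x') $ i\<bar>" by simp
    also have "\<dots> \<le> norm (x - x')" by (rule component_le_norm_cart)
    finally show ?thesis .
  qed
  show ?thesis
    using *[of x x'] *[of x' x] by (simp add: norm_minus_commute abs_le_iff)
qed

abbreviation abs_coord :: "real^'n::finite \<Rightarrow> 'n \<Rightarrow> real" where
  "abs_coord x \<equiv> \<lambda>i. \<bar>x $ i\<bar>"

definition ext_coord :: "('n::finite \<Rightarrow> nat) \<Rightarrow> real^'n \<Rightarrow> 'n option \<Rightarrow> real" where
  "ext_coord \<alpha> x o' = (case o' of None \<Rightarrow> min_coord \<alpha> x | Some i \<Rightarrow> \<bar>x $ i\<bar>)"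

text \<open>Doubled exponents, together with the coordinate \<open>None\<close> of value
  \<open>min_coord \<alpha> x\<close> and exponent 1, make the weight equal to the \<open>H\<close>
  of the overview. Thus \<open>H\<close> is itself a reach weight, and the results on
  \<open>reach_scale\<close> apply to it.\<close>

definition ext_exponent :: "('n::finite \<Rightarrow> nat) \<Rightarrow> 'n option \<Rightarrow> nat" where
  "ext_exponent \<alpha> o' = (case o' of None \<Rightarrow> 1 | Some i \<Rightarrow> 2 * \<alpha> i)"

lemma sum_ext_exponent: "sum (ext_exponent \<alpha>) UNIV = 1 + 2 * sum \<alpha> UNIV"
  by (simp add: UNIV_option_conv sum.reindex ext_exponent_def sum_distrib_left)

lemma ext_coord_nonneg: "\<exists>i. 0 < \<alpha> i \<Longrightarrow> 0 \<le> ext_coord \<alpha> x o'"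
  by (auto simp: ext_coord_def min_coord_nonneg split: option.splits)

lemma ext_coord_lipschitz:
  assumes "\<exists>i. 0 < \<alpha> i"
  shows "\<bar>ext_coord \<alpha> x o' - ext_coord \<alpha> x' o'\<bar> \<le> norm (x - x')"
proof (cases o')
  case None
  then show ?thesis using min_coord_lipschitz[OF assms] by (simp add: ext_coord_def)
next
  case (Some i)
  have "\<bar>\<bar>x $ i\<bar> - \<bar>x' $ i\<bar>\<bar> \<le> \<bar>(x - x') $ i\<bar>" by simp
  also have "\<dots> \<le> norm (x - x')" by (rule component_le_norm_cart)
  finally show ?thesis using Some by (simp add: ext_coord_def)
qed

lemma reach_weight_ext:
  "r * reach_weight (ext_exponent \<alpha>) (ext_coord \<alpha> x) r
    = max (min_coord \<alpha> x) r * (reach_weight \<alpha> (abs_coord x) r)\<^sup>2"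
proof -
  have "(\<Prod>o'\<in>UNIV. max (ext_coord \<alpha> x o') r ^ ext_exponent \<alpha> o')
      = max (min_coord \<alpha> x) r * (\<Prod>i\<in>UNIV. max \<bar>x $ i\<bar> r ^ (2 * \<alpha> i))"
    by (simp add: UNIV_option_conv prod.reindex ext_exponent_def ext_coord_def)
  also have "(\<Prod>i\<in>UNIV. max \<bar>x $ i\<bar> r ^ (2 * \<alpha> i)) = (\<Prod>i\<in>UNIV. max \<bar>x $ i\<bar> r ^ \<alpha> i)\<^sup>2"
    by (simp add: prod_power_distrib mult.commute[of 2] power_mult)
  finally show ?thesis
    by (simp add: reach_weight_def power2_eq_square)
qed

lemma reach_weight_ext_large:
  assumes "min_coord \<alpha> x \<le> r" "0 < r"
  shows "reach_weight (ext_exponent \<alpha>) (ext_coord \<alpha> x) r = (reach_weight \<alpha> (abs_coord x) r)\<^sup>2"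
  using reach_weight_ext[of r \<alpha> x] assms by (simp add: max_absorb2)

text \<open>Each coordinate with positive exponent is at least \<open>r\<close>, so the maxima do
  not depend on \<open>r\<close> and the weight is linear there.\<close>

lemma reach_weight_small:
  assumes "r \<le> min_coord \<alpha> x"
  shows "reach_weight \<alpha> (abs_coord x) r = r * (\<Prod>i\<in>UNIV. \<bar>x $ i\<bar> ^ \<alpha> i)"
proof -
  have "max \<bar>x $ i\<bar> r ^ \<alpha> i = \<bar>x $ i\<bar> ^ \<alpha> i" for i
    using min_coord_le[of \<alpha> i x] assms by (cases "\<alpha> i = 0") (auto simp: max_absorb1)
  then show ?thesis by (simp add: reach_weight_def)
qed

lemma reach_weight_ext_small:
  assumes "r \<le> min_coord \<alpha> x" "0 < r"
  shows "reach_weight (ext_exponent \<alpha>) (ext_coord \<alpha> x) r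
    = r * (min_coord \<alpha> x * (\<Prod>i\<in>UNIV. \<bar>x $ i\<bar> ^ \<alpha> i)\<^sup>2)"
  using reach_weight_ext[of r \<alpha> x] assms
  by (simp add: max_absorb1 reach_weight_small power2_eq_square)

text \<open>The coordinate attaining the minimum lies below \<open>r\<close>, so its maximum is
  \<open>r\<close> itself. Having a positive exponent, it provides a second factor that scales with
  \<open>c\<close>.\<close>

lemma reach_weight_large_scale_ge:
  assumes "\<exists>i. 0 < \<alpha> i" "min_coord \<alpha> x \<le> r" "0 < r" "1 \<le> c"
  shows "c\<^sup>2 * reach_weight \<alpha> (abs_coord x) r \<le> reach_weight \<alpha> (abs_coord x) (c * r)"
proof -
  obtain i where i: "0 < \<alpha> i" "min_coord \<alpha> x = \<bar>x $ i\<bar>"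
    using min_coord_attained[OF assms(1)] by blast
  define Q where "Q s = (\<Prod>j\<in>-{i}. max \<bar>x $ j\<bar> s ^ \<alpha> j)" for s
  have U: "(UNIV :: 'a set) = insert i (-{i})" by auto
  have rcr: "r \<le> c * r" using assms by simp
  have eq: "reach_weight \<alpha> (abs_coord x) s = s * (s ^ \<alpha> i * Q s)" if "r \<le> s" for s
    using that i assms(2) unfolding reach_weight_def by (subst U) (simp add: Q_def max_absorb2)
  have Q: "0 \<le> Q r" "Q r \<le> Q (c * r)"
  proof -
    have "0 \<le> max \<bar>x $ j\<bar> r" "max \<bar>x $ j\<bar> r \<le> max \<bar>x $ j\<bar> (c * r)" for j
      using rcr by linarith+
    then show "0 \<le> Q r" "Q r \<le> Q (c * r)"
      unfolding Q_def by (intro prod_nonneg prod_mono ballI conjI power_mono zero_le_power; simp)+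
  qed
  have "c * r ^ \<alpha> i \<le> c ^ \<alpha> i * r ^ \<alpha> i"
    using assms i by (intro mult_right_mono self_le_power) auto
  then have "(c * r ^ \<alpha> i) * Q r \<le> (c * r) ^ \<alpha> i * Q (c * r)"
    using Q assms by (intro mult_mono) (auto simp: power_mult_distrib)
  then have "(c * r) * ((c * r ^ \<alpha> i) * Q r) \<le> (c * r) * ((c * r) ^ \<alpha> i * Q (c * r))"
    using assms by (intro mult_left_mono) auto
  then show ?thesis
    using eq[of r] eq[OF rcr] by (simp add: power2_eq_square mult_ac)
qed

section \<open>Frequencies and amplitudes\<close>

lemma ex_int_between_powers:
  fixes b h :: real
  assumes "1 < b" "0 < h"
  obtains j :: int where "h \<le> b powi (- j)" "b powi (- (j + 1)) < h"
proof
  define j where "j = \<lfloor>- log b h\<rfloor>"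
  have b: "b powi n = b powr real_of_int n" for n
    using assms by (simp add: powr_real_of_int')
  have h: "h = b powr log b h"
    using assms by simp
  have j: "real_of_int j \<le> - log b h" "- log b h < real_of_int j + 1"
    unfolding j_def by linarith+
  have "b powr log b h \<le> b powr real_of_int (- j)"
    using assms j by (intro powr_mono) auto
  then show "h \<le> b powi (- j)"
    using b h by simp
  have "b powr real_of_int (- (j + 1)) < b powr log b h"
    using assms j by (intro powr_less_mono) auto
  then show "b powi (- (j + 1)) < h"
    using b h by simp
qed

text \<open>With \<open>K = amp_ratio \<alpha>\<close> and \<open>L = K\<^sup>2\<close> as frequency
  base, one frequency step changes the amplitude by a factor of at most \<open>K\<close> in the
  range of quadratic growth, so amplitude times frequency still changes by at least
  \<open>L / K = K \<ge> 2\<close>.\<close>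

definition amp_ratio :: "('n::finite \<Rightarrow> nat) \<Rightarrow> real" where
  "amp_ratio \<alpha> = 2 ^ Suc (sum \<alpha> UNIV)"

definition freq_base :: "('n::finite \<Rightarrow> nat) \<Rightarrow> real" where
  "freq_base \<alpha> = (amp_ratio \<alpha>)\<^sup>2"

definition amplitude :: "('n::finite \<Rightarrow> nat) \<Rightarrow> real^'n \<Rightarrow> int \<Rightarrow> real" where
  "amplitude \<alpha> x j = reach_scale (ext_exponent \<alpha>) (ext_coord \<alpha> x) ((freq_base \<alpha>)\<^sup>2 powi (- j))"

lemma amp_ratio_ge: "2 \<le> amp_ratio \<alpha>"
  using one_le_power[of "2::real" "sum \<alpha> UNIV"] by (simp add: amp_ratio_def)

lemma freq_base_ge: "2 * amp_ratio \<alpha> \<le> freq_base \<alpha>" "4 \<le> freq_base \<alpha>"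
proof -
  show *: "2 * amp_ratio \<alpha> \<le> freq_base \<alpha>"
    using amp_ratio_ge[of \<alpha>] by (simp add: freq_base_def power2_eq_square)
  then show "4 \<le> freq_base \<alpha>"
    using amp_ratio_ge[of \<alpha>] by linarith
qed

text \<open>This is the power that \<open>reach_scale_mult_ge\<close> needs with
  \<open>c = 4\<close>; it makes the amplitudes shrink by at least 4 in each step.\<close>

lemma freq_base_sq: "(freq_base \<alpha>)\<^sup>2 = 4 ^ Suc (sum (ext_exponent \<alpha>) UNIV)"
proof -
  have "Suc (sum (ext_exponent \<alpha>) UNIV) = 2 * Suc (sum \<alpha> UNIV)"
    by (simp add: sum_ext_exponent)
  then have "4 ^ Suc (sum (ext_exponent \<alpha>) UNIV) = (((2::real)\<^sup>2)\<^sup>2) ^ Suc (sum \<alpha> UNIV)"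
    by (simp only: power_mult) simp
  then show ?thesis
    by (simp only: freq_base_def amp_ratio_def power_mult[symmetric] mult_ac)
qed

lemma freq_pow_pos: "0 < freq_base \<alpha> powi j" "0 < (freq_base \<alpha>)\<^sup>2 powi j"
  using freq_base_ge[of \<alpha>] by (auto intro!: zero_less_power_int)

lemma freq_pow_sq: "(freq_base \<alpha>)\<^sup>2 powi j = (freq_base \<alpha> powi j)\<^sup>2"
  by (simp add: power2_eq_square power_int_mult_distrib)

lemma freq_pow_Suc: "freq_base \<alpha> powi (j + 1) = freq_base \<alpha> * freq_base \<alpha> powi j"
  using freq_base_ge[of \<alpha>] by (simp add: power_int_add_1')

lemma freq_sq_step: "(freq_base \<alpha>)\<^sup>2 powi (- j) = (freq_base \<alpha>)\<^sup>2 * (freq_base \<alpha>)\<^sup>2 powi (- (j + 1))"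
proof -
  have "(freq_base \<alpha>)\<^sup>2 powi (- (j + 1) + 1) = (freq_base \<alpha>)\<^sup>2 * (freq_base \<alpha>)\<^sup>2 powi (- (j + 1))"
    using freq_base_ge[of \<alpha>] by (intro power_int_add_1') auto
  then show ?thesis by simp
qed

lemma amplitude_pos: "0 < amplitude \<alpha> x j"
  unfolding amplitude_def by (intro reach_scale_pos freq_pow_pos)

text \<open>Stated for every coordinate vector \<open>z\<close>, since the vectors between two
  points in \<open>reach_scale_sum_lipschitz\<close> need not come from a point.\<close>

lemma reach_scale_freq_decay:
  "reach_scale (ext_exponent \<alpha>) z ((freq_base \<alpha>)\<^sup>2 powi (- (j + 1)))
     \<le> reach_scale (ext_exponent \<alpha>) z ((freq_base \<alpha>)\<^sup>2 powi (- j)) / 4"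
  using reach_scale_mult_ge[of "(freq_base \<alpha>)\<^sup>2 powi (- (j + 1))" 4 "ext_exponent \<alpha>" z, OF freq_pow_pos(2)]
  unfolding freq_base_sq[symmetric] freq_sq_step[symmetric] by simp

lemma amplitude_decay: "amplitude \<alpha> x (j + 1) \<le> amplitude \<alpha> x j / 4"
  unfolding amplitude_def by (rule reach_scale_freq_decay)

lemma amplitude_growth: "amplitude \<alpha> x j \<le> (freq_base \<alpha>)\<^sup>2 * amplitude \<alpha> x (j + 1)"
  unfolding amplitude_def freq_sq_step[of \<alpha> j]
  using freq_base_ge[of \<alpha>] by (intro reach_scale_mult_le freq_pow_pos) simp

lemma amplitude_decay_pow: "amplitude \<alpha> x (j + int n) \<le> amplitude \<alpha> x j * (1/2) ^ n"
proof (induction n)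
  case (Suc n)
  have "amplitude \<alpha> x (j + int (Suc n)) \<le> amplitude \<alpha> x (j + int n) / 4"
    using amplitude_decay[of \<alpha> x "j + int n"] by (simp add: algebra_simps)
  also have "\<dots> \<le> amplitude \<alpha> x (j + int n) / 2"
    using amplitude_pos[of \<alpha> x "j + int n"] by simp
  also have "\<dots> \<le> amplitude \<alpha> x j * (1/2) ^ Suc n"
    using Suc by simp
  finally show ?case .
qed simp

lemma amplitude_antimono: "i \<le> j \<Longrightarrow> amplitude \<alpha> x j \<le> amplitude \<alpha> x i"
proof -
  assume "i \<le> j"
  then have "amplitude \<alpha> x j \<le> amplitude \<alpha> x i * (1/2) ^ nat (j - i)"
    using amplitude_decay_pow[of \<alpha> x i "nat (j - i)"] by simp
  also have "\<dots> \<le> amplitude \<alpha> x i * 1"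
    using amplitude_pos[of \<alpha> x i] by (intro mult_left_mono power_le_one) auto
  finally show ?thesis by simp
qed

lemma reach_weight_amplitude:
  "reach_weight (ext_exponent \<alpha>) (ext_coord \<alpha> x) (amplitude \<alpha> x j) = (freq_base \<alpha>)\<^sup>2 powi (- j)"
  unfolding amplitude_def by (intro reach_weight_reach_scale freq_pow_pos)

text \<open>Up to \<open>min_coord \<alpha> x\<close> the extended weight is linear, so dividing the
  level by \<open>(freq_base \<alpha>)\<^sup>2\<close> divides the solution by the same
  number.\<close>

lemma amplitude_step_small:
  assumes "amplitude \<alpha> x j \<le> min_coord \<alpha> x"
  shows "amplitude \<alpha> x (j + 1) * (freq_base \<alpha>)\<^sup>2 = amplitude \<alpha> x j"
proof -
  define s where "s = amplitude \<alpha> x j / (freq_base \<alpha>)\<^sup>2"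
  have L: "1 \<le> (freq_base \<alpha>)\<^sup>2" and L0: "0 < freq_base \<alpha>"
    using freq_base_ge[of \<alpha>] by simp_all
  have s: "0 < s" "s \<le> amplitude \<alpha> x j"
    using L L0 amplitude_pos[of \<alpha> x j] mult_left_mono[OF L, of "amplitude \<alpha> x j"]
    by (auto simp: s_def divide_le_eq)
  have "(freq_base \<alpha>)\<^sup>2 * reach_weight (ext_exponent \<alpha>) (ext_coord \<alpha> x) s = (freq_base \<alpha>)\<^sup>2 powi (- j)"
    using assms s L0 amplitude_pos[of \<alpha> x j]
    unfolding reach_weight_amplitude[symmetric, of \<alpha> j x]
    by (subst (1 2) reach_weight_ext_small) (auto simp: s_def)
  also have "\<dots> = (freq_base \<alpha>)\<^sup>2 * (freq_base \<alpha>)\<^sup>2 powi (- (j + 1))"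
    by (rule freq_sq_step)
  finally have "reach_weight (ext_exponent \<alpha>) (ext_coord \<alpha> x) s = (freq_base \<alpha>)\<^sup>2 powi (- (j + 1))"
    using L0 by simp
  then have "amplitude \<alpha> x (j + 1) = s"
    unfolding amplitude_def by (rule reach_scale_unique[OF s(1)])
  then show ?thesis using L0 by (simp add: s_def)
qed

text \<open>From \<open>min_coord \<alpha> x\<close> on the extended weight is the square of the
  original one, which grows at least quadratically. Multiplying the scale by \<open>K\<close>
  therefore multiplies the level by at least
  \<open>K ^ 4 = (freq_base \<alpha>)\<^sup>2\<close>.\<close>

lemma amplitude_step_large:
  assumes "\<exists>i. 0 < \<alpha> i" "min_coord \<alpha> x \<le> amplitude \<alpha> x j"
  shows "amplitude \<alpha> x (j - 1) \<le> amp_ratio \<alpha> * amplitude \<alpha> x j"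
proof -
  let ?A = "amplitude \<alpha> x j" and ?K = "amp_ratio \<alpha>" and ?G = "reach_weight \<alpha> (abs_coord x)"
  have A: "0 < ?A" by (rule amplitude_pos)
  have K: "1 \<le> ?K" using amp_ratio_ge[of \<alpha>] by simp
  have le: "?A \<le> ?K * ?A" using A K by simp
  have "(freq_base \<alpha>)\<^sup>2 powi (- (j - 1)) = (freq_base \<alpha>)\<^sup>2 * (?G ?A)\<^sup>2"
    using freq_sq_step[of \<alpha> "j - 1"] reach_weight_ext_large[OF assms(2) A] reach_weight_amplitude[of \<alpha> x j]
    by simp
  also have "\<dots> = (?K\<^sup>2 * ?G ?A)\<^sup>2"
    by (simp add: freq_base_def power_mult_distrib)
  also have "\<dots> \<le> (?G (?K * ?A))\<^sup>2"
    using reach_weight_large_scale_ge[OF assms A K] reach_weight_nonneg[of ?A \<alpha> "abs_coord x"] A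
    by (intro power_mono) auto
  also have "\<dots> = reach_weight (ext_exponent \<alpha>) (ext_coord \<alpha> x) (?K * ?A)"
    using order_trans[OF assms(2) le] A K by (intro reach_weight_ext_large[symmetric]) auto
  finally show ?thesis
    unfolding amplitude_def[of \<alpha> x "j - 1"] using A K by (subst reach_scale_le_iff) (auto intro: freq_pow_pos)
qed

text \<open>With \<open>j0\<close> the index at which the amplitude passes \<open>max r (min_coord \<alpha> x)\<close>, the weighted
  frequency \<open>amplitude j * freq_base^j\<close> decays geometrically for \<open>j < j0\<close>, since there the weight
  grows at least quadratically. For \<open>j > j0\<close> either the amplitude itself decays (when
  \<open>min_coord \<alpha> x \<le> r\<close>) or the extra coordinate makes it proportional to \<open>freq_base^(-2j)\<close>.\<close>
lemma amplitude_profile: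
  fixes x :: "real^'n::finite"
  assumes ex: "\<exists>i. 0 < \<alpha> i" and "0 < r"
  defines "\<eta> \<equiv> reach_weight \<alpha> (abs_coord x) r"
  obtains j0 where "freq_base \<alpha> powi j0 * \<eta> \<le> 1"
    and "r / freq_base \<alpha> \<le> amplitude \<alpha> x j0 * freq_base \<alpha> powi j0 * \<eta>"
    and "amplitude \<alpha> x j0 * freq_base \<alpha> powi j0 * \<eta> \<le> (freq_base \<alpha>)\<^sup>2 * r"
    and "\<And>j. amplitude \<alpha> x j * min 2 (freq_base \<alpha> powi j * \<eta>)
      \<le> freq_base \<alpha> * amp_ratio \<alpha> * (amplitude \<alpha> x j0 * freq_base \<alpha> powi j0 * \<eta>) * (1/2) ^ nat \<bar>j - j0\<bar>"
proof -
  define L where "L = freq_base \<alpha>"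
  define K where "K = amp_ratio \<alpha>"
  define A where "A = amplitude \<alpha> x"
  define \<mu> where "\<mu> = min_coord \<alpha> x"
  define G where "G = reach_weight \<alpha> (abs_coord x)"
  define m where "m = max r \<mu>"
  define s where "s j = A j * L powi j" for j
  have KL: "2 \<le> K" "L = K * K" "4 \<le> L"
    using amp_ratio_ge[of \<alpha>] freq_base_ge[of \<alpha>] by (auto simp: K_def L_def freq_base_def power2_eq_square)
  have LP: "0 < L powi j" for j using freq_pow_pos by (simp add: L_def)
  have Apos: "0 < A j" for j using amplitude_pos by (simp add: A_def)
  have spos: "0 < s j" for j using LP Apos by (simp add: s_def)
  have sSuc: "s (j + 1) = L * (A (j + 1) * L powi j)" for j
    by (simp add: s_def L_def freq_pow_Suc)
  have m: "0 < m" "r \<le> m" "\<mu> \<le> m" using \<open>0 < r\<close> by (auto simp: m_def)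
  have \<eta>: "0 < \<eta>" "\<eta> = G r" using \<open>0 < r\<close> by (auto simp: \<eta>_def G_def reach_weight_pos)
  have Gm: "0 < G m" "\<eta> \<le> G m"
    using m \<open>0 < r\<close> by (auto simp: \<eta>_def G_def reach_weight_pos reach_weight_le_iff)
  \<comment> \<open>If \<open>r < \<mu>\<close>, then \<open>G\<close> is linear up to
    \<open>m = \<mu>\<close>; this identity carries estimates at the threshold \<open>m\<close> back
    to \<open>r\<close>.\<close>
  have lin: "\<eta> * m = r * G m"
  proof (cases "\<mu> \<le> r")
    case True
    then show ?thesis by (simp add: m_def \<eta>)
  next
    case False
    then have "m = \<mu>" "r \<le> \<mu>" by (auto simp: m_def)
    then show ?thesis
      by (simp add: \<eta>(2) G_def \<mu>_def reach_weight_small)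
  qed
  have "1 < L\<^sup>2" using KL power_strict_mono[of 1 L 2] by simp
  \<comment> \<open>The index is chosen so that \<open>A (j0 + 1) < m \<le> A j0\<close>.\<close>
  then obtain j0 where j0: "(G m)\<^sup>2 \<le> L\<^sup>2 powi (- j0)" "L\<^sup>2 powi (- (j0 + 1)) < (G m)\<^sup>2"
    by (rule ex_int_between_powers[where h = "(G m)\<^sup>2"]) (use Gm in auto)
  have H: "reach_weight (ext_exponent \<alpha>) (ext_coord \<alpha> x) m = (G m)\<^sup>2"
    using m by (simp add: G_def \<mu>_def reach_weight_ext_large)
  have A0: "m \<le> A j0"
    using j0(1) m H unfolding A_def amplitude_def L_def by (subst le_reach_scale_iff) (auto intro: freq_pow_pos)
  have "\<not> m \<le> A (j0 + 1)"
    using j0(2) m H unfolding A_def amplitude_def L_def by (subst le_reach_scale_iff) (auto intro: freq_pow_pos)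
  then have A1: "A (j0 + 1) < m" by simp
  have inv: "L powi (- j) = inverse (L powi j)" for j by (simp add: power_int_minus)
  have "(G m)\<^sup>2 \<le> (L powi (- j0))\<^sup>2"
    using j0(1) by (simp add: L_def freq_pow_sq)
  then have "G m \<le> L powi (- j0)"
    using LP[of "- j0"] by (intro power2_le_imp_le[of "G m"]) auto
  \<comment> \<open>Together with \<open>G2\<close> this places \<open>L powi j0 * G m\<close>
    between \<open>1 / L\<close> and 1.\<close>
  then have G1: "L powi j0 * G m \<le> 1"
    using LP[of j0] by (simp add: inv field_simps)
  have "(L powi (- (j0 + 1)))\<^sup>2 < (G m)\<^sup>2"
    using j0(2) by (simp only: L_def freq_pow_sq)
  then have "L powi (- (j0 + 1)) < G m"
    using Gm by (intro power2_less_imp_less[of _ "G m"]) auto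
  then have G2: "1 \<le> L * L powi j0 * G m"
  proof -
    assume "L powi (- (j0 + 1)) < G m"
    then have "1 < L powi (j0 + 1) * G m"
      unfolding inv using LP[of "j0 + 1"] by (simp add: field_simps)
    then show ?thesis by (simp add: L_def freq_pow_Suc)
  qed
  have 1: "L powi j0 * \<eta> \<le> 1"
    using G1 Gm(2) LP[of j0] mult_left_mono[of \<eta> "G m" "L powi j0"] by linarith
  have s\<eta>: "s j0 * \<eta> * G m = A j0 * (L powi j0 * G m) * \<eta>" by (simp add: s_def)
  have 2: "r / L \<le> s j0 * \<eta>"
  proof -
    have "r * G m = m * \<eta> * 1" using lin by (simp add: mult.commute)
    also have "\<dots> \<le> A j0 * \<eta> * (L * L powi j0 * G m)"
      using A0 G2 \<eta>(1) m(1) by (intro mult_mono) auto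
    also have "\<dots> = (L * (s j0 * \<eta>)) * G m"
      by (simp add: s_def)
    finally have "r \<le> L * (s j0 * \<eta>)"
      using Gm(1) by (rule mult_right_le_imp_le)
    then show ?thesis using KL by (simp add: field_simps)
  qed
  \<comment> \<open>The square of \<open>L\<close> comes from
    \<open>A j0 \<le> L\<^sup>2 * A (j0 + 1)\<close> and \<open>A (j0 + 1) < m\<close>.\<close>
  have 3: "s j0 * \<eta> \<le> L\<^sup>2 * r"
  proof -
    have "A j0 \<le> L\<^sup>2 * A (j0 + 1)"
      using amplitude_growth by (simp add: A_def L_def)
    also have "\<dots> \<le> L\<^sup>2 * m"
      using A1 by (intro mult_left_mono) auto
    finally have "A j0 * (L powi j0 * G m) \<le> (L\<^sup>2 * m) * 1"
      using G1 Apos[of j0] LP[of j0] Gm by (intro mult_mono) auto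
    then have "s j0 * \<eta> * G m \<le> (L\<^sup>2 * m) * \<eta>"
      unfolding s\<eta> using \<eta>(1) by (intro mult_right_mono) auto
    also have "\<dots> = (L\<^sup>2 * r) * G m" using lin by (simp add: mult_ac)
    finally show ?thesis using Gm(1) by (rule mult_right_le_imp_le)
  qed
  \<comment> \<open>For indices up to \<open>j0\<close> the amplitudes are at least
    \<open>\<mu>\<close>, so one step back loses at least the factor
    \<open>L / K = K \<ge> 2\<close> in \<open>s\<close>.\<close>
  have below: "s (j0 - int n) \<le> s j0 * (1/2) ^ n" for n
  proof (induction n)
    case (Suc n)
    let ?i = "j0 - int n"
    have "\<mu> \<le> A ?i"
      using A0 m amplitude_antimono[of ?i j0 \<alpha> x] by (simp add: A_def)
    then have "A (?i - 1) \<le> K * A ?i"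
      using amplitude_step_large[OF ex, of x ?i] by (simp add: A_def \<mu>_def K_def)
    then have "A (?i - 1) * L powi (?i - 1) \<le> (K * A ?i) * L powi (?i - 1)"
      using LP[of "?i - 1"] by (intro mult_right_mono) auto
    moreover have "L powi ?i = L * L powi (?i - 1)"
      using freq_pow_Suc[of \<alpha> "?i - 1"] by (simp add: L_def)
    ultimately have "s (?i - 1) * K \<le> s ?i"
      using KL by (simp add: s_def field_simps)
    moreover have "s (?i - 1) * 2 \<le> s (?i - 1) * K"
      using spos[of "?i - 1"] KL by simp
    ultimately have "s (?i - 1) \<le> s ?i / 2" by simp
    also have "\<dots> \<le> s j0 * (1/2) ^ Suc n" using Suc by simp
    finally show ?case by (simp add: algebra_simps)
  qed simp
  have 4: "A j * min 2 (L powi j * \<eta>) \<le> L * K * (s j0 * \<eta>) * (1/2) ^ nat \<bar>j - j0\<bar>" for j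
  proof (cases "j \<le> j0")
    case True
    have "A j * min 2 (L powi j * \<eta>) \<le> s j * \<eta>"
      using Apos[of j] by (auto simp: s_def mult.assoc intro!: mult_left_mono)
    also have "\<dots> \<le> (s j0 * (1/2) ^ nat \<bar>j - j0\<bar>) * \<eta>"
      using below[of "nat (j0 - j)"] True \<eta>(1) by (intro mult_right_mono) auto
    also have "\<dots> = 1 * (s j0 * \<eta>) * (1/2) ^ nat \<bar>j - j0\<bar>" by simp
    also have "\<dots> \<le> L * K * (s j0 * \<eta>) * (1/2) ^ nat \<bar>j - j0\<bar>"
      using KL spos[of j0] \<eta>(1) mult_mono[of 1 L 1 K] by (intro mult_right_mono) auto
    finally show ?thesis .
  next
    case False
    define n where "n = nat (j - j0)"
    have j: "j = j0 + int n" "nat \<bar>j - j0\<bar> = n" "0 < n" using False by (auto simp: n_def)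
    have half: "A j * min 2 (L powi j * \<eta>) \<le> L * 2 * (s j0 * \<eta>) * (1/2) ^ n"
    proof (cases "\<mu> \<le> r")
      case True
      \<comment> \<open>Here \<open>G m = \<eta>\<close>, so \<open>G2\<close> pays for replacing
        the minimum by 2, and the amplitudes alone supply the decay.\<close>
      then have mr: "m = r" by (simp add: m_def)
      have "A j * min 2 (L powi j * \<eta>) \<le> A j * 2"
        using Apos[of j] by (intro mult_left_mono) auto
      also have "\<dots> \<le> (A j0 * (1/2) ^ n) * 2"
        using amplitude_decay_pow[of \<alpha> x j0 n] j by (simp add: A_def)
      also have "\<dots> \<le> (A j0 * (L * L powi j0 * \<eta>) * (1/2) ^ n) * 2"
        using G2 Apos[of j0] mult_left_mono[of 1 "L * L powi j0 * \<eta>" "A j0"] \<eta>(2) mr by simp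
      finally show ?thesis by (simp add: s_def mult_ac)
    next
      case False
      then have mr: "m = \<mu>" by (simp add: m_def)
      \<comment> \<open>Beyond \<open>j0\<close> the amplitudes are below \<open>\<mu>\<close> and
        shrink by exactly \<open>L\<^sup>2\<close>, so \<open>s\<close> shrinks by \<open>L\<close>.
        The induction starts at \<open>j0 + 1\<close>, the first index where this is known.\<close>
      have fwd: "s (j0 + 1 + int k) \<le> s (j0 + 1) * (1/2) ^ k" for k
      proof (induction k)
        case (Suc k)
        let ?i = "j0 + 1 + int k"
        have "A ?i \<le> \<mu>"
          using A1 mr amplitude_antimono[of "j0 + 1" ?i \<alpha> x] by (simp add: A_def)
        then have step: "A (?i + 1) * L\<^sup>2 = A ?i"
          using amplitude_step_small[of \<alpha> x ?i] by (simp add: A_def \<mu>_def L_def)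
        have "s (?i + 1) * L = (A (?i + 1) * L\<^sup>2) * L powi ?i"
          unfolding sSuc power2_eq_square by (simp only: mult_ac)
        then have "s ?i = s (?i + 1) * L"
          unfolding step by (simp only: s_def)
        moreover have "s (?i + 1) * 2 \<le> s (?i + 1) * L"
          using spos[of "?i + 1"] KL by simp
        ultimately have "s (?i + 1) \<le> s ?i / 2" by simp
        also have "\<dots> \<le> s (j0 + 1) * (1/2) ^ Suc k" using Suc by simp
        finally show ?case by (simp add: algebra_simps)
      qed simp
      have "A (j0 + 1) \<le> A j0"
        using amplitude_antimono[of j0 "j0 + 1"] by (simp add: A_def)
      then have s1: "s (j0 + 1) \<le> L * s j0"
        unfolding sSuc using KL LP[of j0] by (auto simp: s_def intro!: mult_left_mono mult_right_mono)
      \<comment> \<open>The late start costs one power of \<open>1/2\<close>, which is the factor 2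
        in \<open>half\<close>.\<close>
      have jn: "j = j0 + 1 + int (n - 1)" using j by simp
      have "A j * min 2 (L powi j * \<eta>) \<le> s j * \<eta>"
        using Apos[of j] by (auto simp: s_def mult.assoc intro!: mult_left_mono)
      also have "\<dots> \<le> (L * s j0 * (1/2) ^ (n - 1)) * \<eta>"
        using order_trans[OF fwd[of "n - 1"] mult_right_mono[OF s1]] jn \<eta>(1)
        by (intro mult_right_mono) auto
      also have "\<dots> = L * 2 * (s j0 * \<eta>) * (1/2) ^ n"
        using j(3) by (cases n) auto
      finally show ?thesis .
    qed
    also have "\<dots> \<le> L * K * (s j0 * \<eta>) * (1/2) ^ n"
      using KL spos[of j0] \<eta>(1) by (intro mult_right_mono mult_left_mono) auto
    finally show ?thesis using j by simp
  qed
  show ?thesis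
    using that[of j0] 1 2 3 4 by (simp add: L_def K_def A_def s_def)
qed

section \<open>Embedding a single vertical coordinate\<close>

lemma norm_cis_diff: "norm (cis a - cis b) = 2 * \<bar>sin ((a - b) / 2)\<bar>"
proof -
  have "(norm (cis a - cis b))\<^sup>2 = (cos a - cos b)\<^sup>2 + (sin a - sin b)\<^sup>2"
    by (simp add: cmod_power2)
  also have "\<dots> = ((sin a)\<^sup>2 + (cos a)\<^sup>2) + ((sin b)\<^sup>2 + (cos b)\<^sup>2) - 2 * (cos a * cos b + sin a * sin b)"
    by (simp only: power2_diff) (simp add: algebra_simps)
  also have "\<dots> = 2 - 2 * cos (a - b)"
    by (simp add: cos_diff)
  also have "\<dots> = (2 * \<bar>sin ((a - b) / 2)\<bar>)\<^sup>2"
  proof -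
    have "cos (a - b) = cos (2 * ((a - b) / 2))" by (rule arg_cong[where f = cos]) simp
    then show ?thesis unfolding cos_double_sin by (simp add: power_mult_distrib)
  qed
  finally show ?thesis
    by (rule power2_eq_imp_eq) auto
qed

lemma norm_cis_diff_le: "norm (cis a - cis b) \<le> min 2 \<bar>a - b\<bar>"
  using abs_sin_x_le_abs_x[of "(a - b) / 2"] abs_sin_le_one[of "(a - b) / 2"]
  by (simp add: norm_cis_diff)

lemma half_le_sin:
  fixes x :: real
  assumes "0 \<le> x" "x \<le> 1"
  shows "x / 2 \<le> sin x"
proof -
  have "sin 0 - 0 / 2 \<le> sin x - x / 2"
  proof (rule DERIV_nonneg_imp_nondecreasing[OF assms(1)])
    fix t assume t: "0 \<le> t" "t \<le> x"
    \<comment> \<open>The interval up to 1 lies within \<open>pi / 3\<close>, where the cosine is at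
      least \<open>1/2\<close>.\<close>
    have "cos (pi / 3) \<le> cos t"
      using t assms pi_gt3 by (intro cos_monotone_0_pi_le) auto
    then have "0 \<le> cos t - 1 / 2" by (simp add: cos_60)
    moreover have "((\<lambda>t. sin t - t / 2) has_real_derivative cos t - 1 / 2) (at t)"
      by (auto intro!: derivative_eq_intros)
    ultimately show "\<exists>y. ((\<lambda>t. sin t - t / 2) has_real_derivative y) (at t) \<and> 0 \<le> y"
      by blast
  qed
  then show ?thesis by simp
qed

lemma norm_cis_diff_ge:
  assumes "\<bar>a - b\<bar> \<le> 1"
  shows "\<bar>a - b\<bar> / 2 \<le> norm (cis a - cis b)"
proof -
  have "\<bar>sin ((a - b) / 2)\<bar> = \<bar>sin (\<bar>a - b\<bar> / 2)\<bar>"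
    using sin_minus[of "(b - a) / 2"] by (cases "a \<le> b") (simp_all add: minus_divide_left)
  moreover have "\<bar>a - b\<bar> / 2 / 2 \<le> sin (\<bar>a - b\<bar> / 2)"
    using assms by (intro half_le_sin) auto
  ultimately show ?thesis
    by (simp add: norm_cis_diff)
qed

section \<open>Convergence and estimates of the lacunary series\<close>

lemma abs_summable_bounded_finite_sums:
  fixes f :: "'b \<Rightarrow> 'a::banach"
  assumes "\<And>F. finite F \<Longrightarrow> F \<subseteq> A \<Longrightarrow> (\<Sum>x\<in>F. norm (f x)) \<le> C"
  shows "f summable_on A" "norm (infsum f A) \<le> C"
proof -
  have *: "f abs_summable_on A"
    using assms by (intro nonneg_bdd_above_summable_on) (auto intro!: bdd_aboveI2)
  then show "f summable_on A" by (rule abs_summable_summable)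
  have "norm (infsum f A) \<le> infsum (\<lambda>x. norm (f x)) A"
    by (rule norm_infsum_bound[OF *])
  also have "\<dots> \<le> C"
    by (rule infsum_le_finite_sums[OF *]) (use assms in auto)
  finally show "norm (infsum f A) \<le> C" .
qed

text \<open>Subtracting 1 makes the wave vanish at \<open>y = 0\<close>; this gives convergence as
  \<open>j\<close> tends to minus infinity, where the amplitudes are unbounded.\<close>

definition wave :: "('n::finite \<Rightarrow> nat) \<Rightarrow> real^'n \<Rightarrow> real \<Rightarrow> int \<Rightarrow> complex" where
  "wave \<alpha> x y j = amplitude \<alpha> x j *\<^sub>R (cis (freq_base \<alpha> powi j * y) - 1)"

lemma norm_wave_diff_y:
  "norm (wave \<alpha> x y j - wave \<alpha> x y' j)
    = amplitude \<alpha> x j * norm (cis (freq_base \<alpha> powi j * y) - cis (freq_base \<alpha> powi j * y'))"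
proof -
  have "wave \<alpha> x y j - wave \<alpha> x y' j
      = amplitude \<alpha> x j *\<^sub>R (cis (freq_base \<alpha> powi j * y) - cis (freq_base \<alpha> powi j * y'))"
    by (simp add: wave_def algebra_simps)
  then show ?thesis
    using amplitude_pos[of \<alpha> x j] by (simp add: less_imp_le)
qed

lemma norm_wave_diff_y_le:
  "norm (wave \<alpha> x y j - wave \<alpha> x y' j) \<le> amplitude \<alpha> x j * min 2 (freq_base \<alpha> powi j * \<bar>y - y'\<bar>)"
proof -
  have "\<bar>freq_base \<alpha> powi j * y - freq_base \<alpha> powi j * y'\<bar> = freq_base \<alpha> powi j * \<bar>y - y'\<bar>"
    using freq_pow_pos(1)[of \<alpha> j] by (simp add: abs_mult right_diff_distrib[symmetric])
  then show ?thesis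
    using norm_cis_diff_le[of "freq_base \<alpha> powi j * y" "freq_base \<alpha> powi j * y'"] amplitude_pos[of \<alpha> x j]
    unfolding norm_wave_diff_y by (intro mult_left_mono) auto
qed

text \<open>The first summand serves the variation in \<open>y\<close>: a two-sided geometric sum
  times the constants of \<open>amplitude_profile\<close>. The second serves the variation in
  \<open>x\<close>: the diameter 2 of the circle times the variation of the amplitudes.\<close>

definition wave_lip :: "('n::finite \<Rightarrow> nat) \<Rightarrow> real" where
  "wave_lip \<alpha> = 4 * (freq_base \<alpha> * amp_ratio \<alpha> * (freq_base \<alpha>)\<^sup>2) + 8 * real (sum (ext_exponent \<alpha>) UNIV)"

lemma wave_lip_ge:
  "4 * (freq_base \<alpha> * amp_ratio \<alpha> * (freq_base \<alpha>)\<^sup>2) \<le> wave_lip \<alpha>"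
  "8 * real (sum (ext_exponent \<alpha>) UNIV) \<le> wave_lip \<alpha>"
  "0 < wave_lip \<alpha>"
proof -
  have "0 < freq_base \<alpha> * amp_ratio \<alpha> * (freq_base \<alpha>)\<^sup>2"
    using freq_base_ge[of \<alpha>] amp_ratio_ge[of \<alpha>] by (intro mult_pos_pos) auto
  moreover have "0 \<le> real (sum (ext_exponent \<alpha>) UNIV)" by (rule of_nat_0_le_iff)
  ultimately show "4 * (freq_base \<alpha> * amp_ratio \<alpha> * (freq_base \<alpha>)\<^sup>2) \<le> wave_lip \<alpha>"
    "8 * real (sum (ext_exponent \<alpha>) UNIV) \<le> wave_lip \<alpha>" "0 < wave_lip \<alpha>"
    unfolding wave_lip_def by linarith+
qed

lemma sum_norm_wave_diff_y:
  assumes ex: "\<exists>i. 0 < \<alpha> i" and "0 \<le> r" "\<bar>y - y'\<bar> \<le> reach_weight \<alpha> (abs_coord x) r" "finite J"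
  shows "(\<Sum>j\<in>J. norm (wave \<alpha> x y j - wave \<alpha> x y' j)) \<le> wave_lip \<alpha> * r"
proof -
  have lip: "0 \<le> wave_lip \<alpha>"
    using wave_lip_ge(3)[of \<alpha>] by simp
  \<comment> \<open>The profile needs the exact scale of the displacement, of which \<open>r\<close>
    is only an upper bound.\<close>
  obtain s where s: "0 \<le> s" "reach_weight \<alpha> (abs_coord x) s = \<bar>y - y'\<bar>"
    using ex_reach_weight_eq[of "\<bar>y - y'\<bar>" \<alpha> "abs_coord x"] by auto
  have "s \<le> r"
    using reach_weight_le_iff[OF s(1) assms(2), of \<alpha> "abs_coord x"] s(2) assms(3) by simp
  show ?thesis
  proof (cases "s = 0")
    case True
    then have "y = y'" using s by simp
    then show ?thesis using lip assms(2) by simp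
  next
    case False
    with s have "0 < s" by simp
    define Y where "Y = freq_base \<alpha> * amp_ratio \<alpha>"
    have Y: "0 \<le> Y" using freq_base_ge[of \<alpha>] amp_ratio_ge[of \<alpha>] by (auto simp: Y_def)
    obtain j0 B where B: "B \<le> (freq_base \<alpha>)\<^sup>2 * s"
      "\<And>j. amplitude \<alpha> x j * min 2 (freq_base \<alpha> powi j * \<bar>y - y'\<bar>) \<le> Y * B * (1/2) ^ nat \<bar>j - j0\<bar>"
      using amplitude_profile[OF ex \<open>0 < s\<close>, of x] unfolding s(2) Y_def by metis
    have "(\<Sum>j\<in>J. norm (wave \<alpha> x y j - wave \<alpha> x y' j)) \<le> (\<Sum>j\<in>J. Y * ((freq_base \<alpha>)\<^sup>2 * s) * (1/2) ^ nat \<bar>j - j0\<bar>)"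
    proof (rule sum_mono)
      fix j
      have "norm (wave \<alpha> x y j - wave \<alpha> x y' j) \<le> Y * B * (1/2) ^ nat \<bar>j - j0\<bar>"
        using norm_wave_diff_y_le B(2) by (rule order_trans)
      also have "\<dots> \<le> Y * ((freq_base \<alpha>)\<^sup>2 * s) * (1/2) ^ nat \<bar>j - j0\<bar>"
        using B(1) Y by (intro mult_right_mono mult_left_mono) auto
      finally show "norm (wave \<alpha> x y j - wave \<alpha> x y' j) \<le> Y * ((freq_base \<alpha>)\<^sup>2 * s) * (1/2) ^ nat \<bar>j - j0\<bar>" .
    qed
    also have "\<dots> = Y * ((freq_base \<alpha>)\<^sup>2 * s) * (\<Sum>j\<in>J. (1/2) ^ nat \<bar>j - j0\<bar>)"
      by (simp add: sum_distrib_left)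
    also have "\<dots> \<le> Y * ((freq_base \<alpha>)\<^sup>2 * s) * 4"
      using sum_half_powers_int_le[OF assms(4), of 0 j0] Y s(1) by (intro mult_left_mono) auto
    also have "\<dots> = 4 * (Y * (freq_base \<alpha>)\<^sup>2) * s" by simp
    also have "\<dots> \<le> wave_lip \<alpha> * r"
      using \<open>s \<le> r\<close> lip s(1) wave_lip_ge(1)[of \<alpha>] by (intro mult_mono) (auto simp: Y_def)
    finally show ?thesis .
  qed
qed

text \<open>Only the amplitudes depend on \<open>x\<close>, and the oscillating factor is bounded by
  2. The sum of their variations is controlled by \<open>reach_scale_sum_lipschitz\<close>.\<close>

lemma sum_norm_wave_diff_x:
  assumes ex: "\<exists>i. 0 < \<alpha> i" and "finite J"
  shows "(\<Sum>j\<in>J. norm (wave \<alpha> x y j - wave \<alpha> x' y j)) \<le> wave_lip \<alpha> * norm (x - x')"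
proof -
  have "norm (wave \<alpha> x y j - wave \<alpha> x' y j) \<le> 2 * \<bar>amplitude \<alpha> x j - amplitude \<alpha> x' j\<bar>" for j
  proof -
    have "wave \<alpha> x y j - wave \<alpha> x' y j
        = (amplitude \<alpha> x j - amplitude \<alpha> x' j) *\<^sub>R (cis (freq_base \<alpha> powi j * y) - cis 0)"
      by (simp add: wave_def algebra_simps)
    then show ?thesis
      using norm_cis_diff_le[of "freq_base \<alpha> powi j * y" 0]
        mult_left_mono[of "norm (cis (freq_base \<alpha> powi j * y) - cis 0)" 2 "\<bar>amplitude \<alpha> x j - amplitude \<alpha> x' j\<bar>"]
      by (simp add: mult.commute)
  qed
  then have "(\<Sum>j\<in>J. norm (wave \<alpha> x y j - wave \<alpha> x' y j)) \<le> 2 * (\<Sum>j\<in>J. \<bar>amplitude \<alpha> x j - amplitude \<alpha> x' j\<bar>)"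
    by (simp add: sum_distrib_left sum_mono)
  also have "(\<Sum>j\<in>J. \<bar>amplitude \<alpha> x j - amplitude \<alpha> x' j\<bar>)
      \<le> (\<Sum>i\<in>UNIV. 4 * real (ext_exponent \<alpha> i) * \<bar>ext_coord \<alpha> x i - ext_coord \<alpha> x' i\<bar>)"
    unfolding amplitude_def
  proof (rule reach_scale_sum_lipschitz[where T = "\<lambda>j. (freq_base \<alpha>)\<^sup>2 powi (- j)"])
    fix z :: "'a option \<Rightarrow> real" and j :: int
    show "reach_scale (ext_exponent \<alpha>) z ((freq_base \<alpha>)\<^sup>2 powi (- (j + 1)))
        \<le> reach_scale (ext_exponent \<alpha>) z ((freq_base \<alpha>)\<^sup>2 powi (- j)) / 2"
      using reach_scale_freq_decay[of \<alpha> z j] reach_scale_pos[OF freq_pow_pos(2), of "ext_exponent \<alpha>" z \<alpha> "- j"]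
      by simp
  qed (use freq_pow_pos ext_coord_nonneg[OF ex] assms(2) in auto)
  also have "\<dots> \<le> (\<Sum>i\<in>UNIV. 4 * real (ext_exponent \<alpha> i) * norm (x - x'))"
    using ext_coord_lipschitz[OF ex] by (intro sum_mono mult_left_mono) auto
  also have "\<dots> = 4 * real (sum (ext_exponent \<alpha>) UNIV) * norm (x - x')"
    by (simp add: sum_distrib_left sum_distrib_right)
  finally have "(\<Sum>j\<in>J. norm (wave \<alpha> x y j - wave \<alpha> x' y j))
      \<le> (8 * real (sum (ext_exponent \<alpha>) UNIV)) * norm (x - x')" by simp
  also have "\<dots> \<le> wave_lip \<alpha> * norm (x - x')"
    by (intro mult_right_mono wave_lip_ge) auto
  finally show ?thesis .
qed

definition wave_sum :: "('n::finite \<Rightarrow> nat) \<Rightarrow> int set \<Rightarrow> real^'n \<Rightarrow> real \<Rightarrow> complex" where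
  "wave_sum \<alpha> S x y = infsum (wave \<alpha> x y) S"

text \<open>All waves vanish at \<open>y = 0\<close>, so the estimate for differences in
  \<open>y\<close> already bounds the finite partial sums.\<close>

lemma wave_summable:
  assumes ex: "\<exists>i. 0 < \<alpha> i"
  shows "wave \<alpha> x y summable_on S"
proof -
  obtain r where r: "0 \<le> r" "reach_weight \<alpha> (abs_coord x) r = \<bar>y - 0\<bar>"
    using ex_reach_weight_eq[of "\<bar>y - 0\<bar>" \<alpha> "abs_coord x"] by auto
  have "wave \<alpha> x 0 j = 0" for j by (simp add: wave_def)
  then show ?thesis
    using sum_norm_wave_diff_y[OF ex r(1), of y 0 x] r(2)
    by (intro abs_summable_bounded_finite_sums[where C = "wave_lip \<alpha> * r"]) simp
qed

lemma wave_sum_diff: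
  assumes ex: "\<exists>i. 0 < \<alpha> i"
  shows "wave_sum \<alpha> S x y - wave_sum \<alpha> S x' y' = infsum (\<lambda>j. wave \<alpha> x y j - wave \<alpha> x' y' j) S"
proof -
  have "infsum (\<lambda>j. wave \<alpha> x y j + - wave \<alpha> x' y' j) S
      = wave_sum \<alpha> S x y + infsum (\<lambda>j. - wave \<alpha> x' y' j) S"
    unfolding wave_sum_def by (intro infsum_add wave_summable[OF ex] iffD2[OF summable_on_uminus])
  then show ?thesis by (simp add: infsum_uminus wave_sum_def)
qed

lemma wave_sum_lipschitz_x:
  assumes ex: "\<exists>i. 0 < \<alpha> i"
  shows "norm (wave_sum \<alpha> S x y - wave_sum \<alpha> S x' y) \<le> wave_lip \<alpha> * norm (x - x')"
  unfolding wave_sum_diff[OF ex]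
  by (rule abs_summable_bounded_finite_sums) (rule sum_norm_wave_diff_x[OF ex])

lemma wave_sum_lipschitz_y:
  assumes ex: "\<exists>i. 0 < \<alpha> i" and "0 \<le> r" "\<bar>y - y'\<bar> \<le> reach_weight \<alpha> (abs_coord x) r"
  shows "norm (wave_sum \<alpha> S x y - wave_sum \<alpha> S x y') \<le> wave_lip \<alpha> * r"
  unfolding wave_sum_diff[OF ex]
  by (rule abs_summable_bounded_finite_sums) (rule sum_norm_wave_diff_y[OF assms])

text \<open>The height is changed first, over \<open>x\<close>, because the weight bounding its
  displacement is taken at \<open>x\<close>.\<close>

lemma wave_sum_lipschitz:
  assumes ex: "\<exists>i. 0 < \<alpha> i" and "0 \<le> r" "\<bar>y - y'\<bar> \<le> reach_weight \<alpha> (abs_coord x) r"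
  shows "norm (wave_sum \<alpha> S x y - wave_sum \<alpha> S x' y') \<le> wave_lip \<alpha> * (norm (x - x') + r)"
  using norm_triangle_ineq[of "wave_sum \<alpha> S x y - wave_sum \<alpha> S x y'" "wave_sum \<alpha> S x y' - wave_sum \<alpha> S x' y'"]
    wave_sum_lipschitz_x[OF ex, of S x y' x'] wave_sum_lipschitz_y[OF assms, of S]
  by (simp add: distrib_left)

text \<open>Grouping the frequencies by residue class modulo a large \<open>M\<close> isolates the dominant one.\<close>
lemma wave_sum_lower_y:
  fixes x :: "real^'n::finite"
  assumes ex: "\<exists>i. 0 < \<alpha> i" and "0 < r" and eq: "reach_weight \<alpha> (abs_coord x) r = \<bar>y - y'\<bar>"
    and "0 < M" and M: "freq_base \<alpha> * amp_ratio \<alpha> * (4 * (1/2) ^ M) \<le> 1/4"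
  obtains c where "c \<in> {0..<int M}"
    "r \<le> 4 * freq_base \<alpha> * norm (wave_sum \<alpha> {j. j mod int M = c} x y - wave_sum \<alpha> {j. j mod int M = c} x y')"
proof -
  define Y where "Y = freq_base \<alpha> * amp_ratio \<alpha>"
  have Y: "0 \<le> Y" using freq_base_ge[of \<alpha>] amp_ratio_ge[of \<alpha>] by (auto simp: Y_def)
  obtain j0 where j0: "freq_base \<alpha> powi j0 * \<bar>y - y'\<bar> \<le> 1"
    "r / freq_base \<alpha> \<le> amplitude \<alpha> x j0 * freq_base \<alpha> powi j0 * \<bar>y - y'\<bar>"
    "\<And>j. amplitude \<alpha> x j * min 2 (freq_base \<alpha> powi j * \<bar>y - y'\<bar>)
      \<le> Y * (amplitude \<alpha> x j0 * freq_base \<alpha> powi j0 * \<bar>y - y'\<bar>) * (1/2) ^ nat \<bar>j - j0\<bar>"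
    using amplitude_profile[OF ex \<open>0 < r\<close>, of x] unfolding eq Y_def by metis
  define B where "B = amplitude \<alpha> x j0 * freq_base \<alpha> powi j0 * \<bar>y - y'\<bar>"
  have B: "0 \<le> B"
    using amplitude_pos[of \<alpha> x j0] freq_pow_pos(1)[of \<alpha> j0] by (auto simp: B_def)
  \<comment> \<open>The residue class of the dominant index \<open>j0\<close>; its other members are
    at least \<open>M\<close> away from \<open>j0\<close>.\<close>
  define c where "c = j0 mod int M"
  define S where "S = {j. j mod int M = c}"
  define d where "d = (\<lambda>j. wave \<alpha> x y j - wave \<alpha> x y' j)"
  \<comment> \<open>The phase difference at \<open>j0\<close> is at most 1, so the chord is at least
    half of it.\<close>
  have main: "B / 2 \<le> norm (d j0)"
  proof -
    have abs: "\<bar>freq_base \<alpha> powi j0 * y - freq_base \<alpha> powi j0 * y'\<bar> = freq_base \<alpha> powi j0 * \<bar>y - y'\<bar>"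
      using freq_pow_pos(1)[of \<alpha> j0] by (simp add: abs_mult right_diff_distrib[symmetric])
    then have "amplitude \<alpha> x j0 * ((freq_base \<alpha> powi j0 * \<bar>y - y'\<bar>) / 2) \<le> norm (d j0)"
      using norm_cis_diff_ge[of "freq_base \<alpha> powi j0 * y" "freq_base \<alpha> powi j0 * y'"] amplitude_pos[of \<alpha> x j0] j0(1)
      unfolding d_def norm_wave_diff_y by (intro mult_left_mono) auto
    then show ?thesis by (simp add: B_def mult.assoc)
  qed
  have far: "int M \<le> \<bar>j - j0\<bar>" if "j \<in> S - {j0}" for j
  proof -
    have "int M dvd j - j0"
      using that by (simp add: S_def c_def mod_eq_dvd_iff)
    then have "int M dvd \<bar>j - j0\<bar>" by simp
    then show ?thesis
      using that by (intro zdvd_imp_le) auto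
  qed
  \<comment> \<open>The choice of \<open>M\<close> limits all other terms of the class to half of
    the lower bound for the dominant one.\<close>
  have rest: "(\<Sum>j\<in>F. norm (d j)) \<le> B / 4" if F: "finite F" "F \<subseteq> S - {j0}" for F
  proof -
    have "(\<Sum>j\<in>F. norm (d j)) \<le> (\<Sum>j\<in>F. Y * B * (1/2) ^ nat \<bar>j - j0\<bar>)"
      using j0(3) norm_wave_diff_y_le[of \<alpha> x y _ y'] unfolding d_def B_def
      by (intro sum_mono) (rule order_trans)
    also have "\<dots> = Y * B * (\<Sum>j\<in>F. (1/2) ^ nat \<bar>j - j0\<bar>)"
      by (simp add: sum_distrib_left)
    also have "\<dots> \<le> Y * B * (4 * (1/2) ^ M)"
      using F far Y B by (intro mult_left_mono sum_half_powers_int_le) auto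
    also have "\<dots> = B * (Y * (4 * (1/2) ^ M))"
      by (simp only: mult_ac)
    also have "\<dots> \<le> B * (1/4)"
      using M B by (intro mult_left_mono) (auto simp: Y_def)
    finally show ?thesis by simp
  qed
  have "j0 \<in> S" by (simp add: S_def c_def)
  then have "wave_sum \<alpha> S x y - wave_sum \<alpha> S x y' = infsum d (insert j0 (S - {j0}))"
    unfolding wave_sum_diff[OF ex] d_def by (simp add: insert_absorb)
  also have "\<dots> = d j0 + infsum d (S - {j0})"
    by (intro infsum_insert abs_summable_bounded_finite_sums(1)[OF rest]) auto
  finally have "norm (d j0) - norm (infsum d (S - {j0})) \<le> norm (wave_sum \<alpha> S x y - wave_sum \<alpha> S x y')"
    using norm_diff_ineq[of "d j0" "infsum d (S - {j0})"] by simp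
  moreover have "norm (infsum d (S - {j0})) \<le> B / 4"
    by (rule abs_summable_bounded_finite_sums(2)[OF rest])
  ultimately have "B / 4 \<le> norm (wave_sum \<alpha> S x y - wave_sum \<alpha> S x y')"
    using main by linarith
  moreover have "r / freq_base \<alpha> \<le> B" using j0(2) by (simp add: B_def)
  ultimately have "r / freq_base \<alpha> \<le> 4 * norm (wave_sum \<alpha> S x y - wave_sum \<alpha> S x y')" by linarith
  then have "r \<le> 4 * freq_base \<alpha> * norm (wave_sum \<alpha> S x y - wave_sum \<alpha> S x y')"
    using freq_base_ge[of \<alpha>] by (simp add: field_simps)
  moreover have "c \<in> {0..<int M}"
    using \<open>0 < M\<close> by (simp add: c_def)
  ultimately show ?thesis
    using that[of c] by (simp add: S_def)
qed

text \<open>The family together with \<open>norm (x - x')\<close> is compared with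
  \<open>norm (x - x') + r\<close>, where \<open>r\<close> is a scale sufficient for the vertical
  displacement. Using inequalities for \<open>r\<close> avoids the inverse function, which is
  unspecified at displacement 0.\<close>

definition line_embedding ::
  "('n::finite \<Rightarrow> nat) \<Rightarrow> (real^'n \<Rightarrow> real \<Rightarrow> real) set \<Rightarrow> real \<Rightarrow> bool" where
  "line_embedding \<alpha> \<Phi> C \<longleftrightarrow> finite \<Phi> \<and> 0 < C \<and>
    (\<forall>\<phi>\<in>\<Phi>. \<forall>x y x' y' r. 0 \<le> r \<longrightarrow> \<bar>y - y'\<bar> \<le> reach_weight \<alpha> (abs_coord x) r
      \<longrightarrow> \<bar>\<phi> x y - \<phi> x' y'\<bar> \<le> C * (norm (x - x') + r)) \<and>
    (\<forall>x y x' y'. \<exists>r\<ge>0. \<bar>y - y'\<bar> \<le> reach_weight \<alpha> (abs_coord x) r \<and>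
      r \<le> C * (norm (x - x') + (\<Sum>\<phi>\<in>\<Phi>. \<bar>\<phi> x y - \<phi> x' y'\<bar>)))"

lemma line_embeddingI:
  assumes "finite \<Phi>" "0 < C"
    "\<And>\<phi> x y x' y' r. \<lbrakk>\<phi> \<in> \<Phi>; 0 \<le> r; \<bar>y - y'\<bar> \<le> reach_weight \<alpha> (abs_coord x) r\<rbrakk>
      \<Longrightarrow> \<bar>\<phi> x y - \<phi> x' y'\<bar> \<le> C * (norm (x - x') + r)"
    "\<And>x y x' y'. \<exists>r\<ge>0. \<bar>y - y'\<bar> \<le> reach_weight \<alpha> (abs_coord x) r \<and>
      r \<le> C * (norm (x - x') + (\<Sum>\<phi>\<in>\<Phi>. \<bar>\<phi> x y - \<phi> x' y'\<bar>))"
  shows "line_embedding \<alpha> \<Phi> C"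
  unfolding line_embedding_def by (intro conjI ballI allI impI assms)

lemma ex_line_embedding:
  fixes \<alpha> :: "'n::finite \<Rightarrow> nat"
  shows "\<exists>\<Phi> C. line_embedding \<alpha> \<Phi> C"
proof (cases "\<exists>i. 0 < \<alpha> i")
  case False
  \<comment> \<open>Without positive exponents the weight of \<open>r\<close> is \<open>r\<close>,
    and \<open>y\<close> itself serves as the only function.\<close>
  then have rw: "reach_weight \<alpha> z r = r" for z r by (simp add: reach_weight_def)
  show ?thesis
  proof (rule exI, rule exI, rule line_embeddingI[of "{\<lambda>x y. y}" 1])
    fix \<phi> :: "real^'n \<Rightarrow> real \<Rightarrow> real" and x x' :: "real^'n" and y y' r :: real
    assume "\<phi> \<in> {\<lambda>x y. y}" "0 \<le> r" "\<bar>y - y'\<bar> \<le> reach_weight \<alpha> (abs_coord x) r"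
    then show "\<bar>\<phi> x y - \<phi> x' y'\<bar> \<le> 1 * (norm (x - x') + r)"
      using norm_ge_zero[of "x - x'"] by (auto simp: rw simp del: norm_ge_zero)
  next
    fix x x' :: "real^'n" and y y' :: real
    show "\<exists>r\<ge>0. \<bar>y - y'\<bar> \<le> reach_weight \<alpha> (abs_coord x) r \<and>
      r \<le> 1 * (norm (x - x') + (\<Sum>\<phi>\<in>{\<lambda>x y. y}. \<bar>\<phi> x y - \<phi> x' y'\<bar>))"
      by (intro exI[of _ "\<bar>y - y'\<bar>"]) (simp add: rw)
  qed auto
next
  case ex: True
  define Y where "Y = freq_base \<alpha> * amp_ratio \<alpha>"
  have Y: "0 < Y" using freq_base_ge[of \<alpha>] amp_ratio_ge[of \<alpha>] by (auto simp: Y_def)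
  obtain M0 where "(1/2::real) ^ M0 < 1 / (16 * Y)"
    using real_arch_pow_inv[of "1 / (16 * Y)" "1/2"] Y by auto
  then have "(1/2::real) ^ Suc M0 \<le> 1 / (16 * Y)"
    using zero_le_power[of "1/2::real" M0] unfolding power_Suc by linarith
  then have M: "freq_base \<alpha> * amp_ratio \<alpha> * (4 * (1/2) ^ Suc M0) \<le> 1/4"
    using Y unfolding Y_def[symmetric] by (simp add: field_simps)
  define E where "E c = wave_sum \<alpha> {j. j mod int (Suc M0) = c}" for c
  \<comment> \<open>The real and imaginary parts of one series for each residue class.\<close>
  define \<Phi> where "\<Phi> = (\<lambda>c x y. Re (E c x y)) ` {0..<int (Suc M0)} \<union> (\<lambda>c x y. Im (E c x y)) ` {0..<int (Suc M0)}"
  define W where "W = 4 * freq_base \<alpha>"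
  have W: "0 < W" using freq_base_ge[of \<alpha>] by (simp add: W_def)
  have lip: "0 < wave_lip \<alpha>"
    by (rule wave_lip_ge)
  define C where "C = 2 * W + wave_lip \<alpha> + W * wave_lip \<alpha>"
  have C: "0 < C" "2 * W \<le> C" "W * wave_lip \<alpha> \<le> C" "wave_lip \<alpha> \<le> C"
    using W lip mult_pos_pos[OF W lip] unfolding C_def by linarith+
  have fin: "finite \<Phi>" by (simp add: \<Phi>_def)
  show ?thesis
  proof (rule exI, rule exI, rule line_embeddingI[OF fin C(1)])
    fix \<phi> and x x' :: "real^'n" and y y' r :: real
    assume \<phi>: "\<phi> \<in> \<Phi>" and r: "0 \<le> r" "\<bar>y - y'\<bar> \<le> reach_weight \<alpha> (abs_coord x) r"
    then obtain c where "\<phi> = (\<lambda>x y. Re (E c x y)) \<or> \<phi> = (\<lambda>x y. Im (E c x y))"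
      by (auto simp: \<Phi>_def)
    then have "\<bar>\<phi> x y - \<phi> x' y'\<bar> \<le> norm (E c x y - E c x' y')"
      using abs_Re_le_cmod[of "E c x y - E c x' y'"] abs_Im_le_cmod[of "E c x y - E c x' y'"] by auto
    also have "\<dots> \<le> wave_lip \<alpha> * (norm (x - x') + r)"
      unfolding E_def by (rule wave_sum_lipschitz[OF ex r])
    also have "\<dots> \<le> C * (norm (x - x') + r)"
      using C r by (intro mult_right_mono) auto
    finally show "\<bar>\<phi> x y - \<phi> x' y'\<bar> \<le> C * (norm (x - x') + r)" .
  next
    fix x x' :: "real^'n" and y y' :: real
    let ?s = "\<Sum>\<phi>\<in>\<Phi>. \<bar>\<phi> x y - \<phi> x' y'\<bar>"
    have s0: "0 \<le> ?s" by (intro sum_nonneg) auto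
    obtain r where r: "0 \<le> r" "reach_weight \<alpha> (abs_coord x) r = \<bar>y - y'\<bar>"
      using ex_reach_weight_eq[of "\<bar>y - y'\<bar>" \<alpha> "abs_coord x"] by auto
    have "r \<le> C * (norm (x - x') + ?s)"
    proof (cases "r = 0")
      case True
      then show ?thesis using C s0 by simp
    next
      case False
      with r have "0 < r" by simp
      obtain c where c: "c \<in> {0..<int (Suc M0)}" "r \<le> W * norm (E c x y - E c x y')"
        using wave_sum_lower_y[OF ex \<open>0 < r\<close> r(2) _ M] unfolding E_def W_def by auto
      have "(\<lambda>x y. Re (E c x y)) \<in> \<Phi>" "(\<lambda>x y. Im (E c x y)) \<in> \<Phi>"
        using c(1) by (auto simp: \<Phi>_def)
      then have "\<bar>Re (E c x y) - Re (E c x' y')\<bar> \<le> ?s" "\<bar>Im (E c x y) - Im (E c x' y')\<bar> \<le> ?s"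
        using member_le_sum[OF _ _ fin, of _ "\<lambda>\<phi>. \<bar>\<phi> x y - \<phi> x' y'\<bar>"] by fastforce+
      then have "norm (E c x y - E c x' y') \<le> 2 * ?s"
        using cmod_le[of "E c x y - E c x' y'"] by simp
      \<comment> \<open>The lower bound is available only over a common \<open>x\<close>; passing
        from \<open>x'\<close> to \<open>x\<close> costs a multiple of \<open>norm (x - x')\<close>,
        which the claim permits.\<close>
      moreover have "norm (E c x' y' - E c x y') \<le> wave_lip \<alpha> * norm (x - x')"
        using wave_sum_lipschitz_x[OF ex, of _ x y' x'] by (simp add: E_def norm_minus_commute)
      moreover have "norm (E c x y - E c x y') \<le> norm (E c x y - E c x' y') + norm (E c x' y' - E c x y')"
        using norm_triangle_ineq[of "E c x y - E c x' y'" "E c x' y' - E c x y'"] by simp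
      ultimately have "norm (E c x y - E c x y') \<le> 2 * ?s + wave_lip \<alpha> * norm (x - x')" by linarith
      then have "r \<le> W * (2 * ?s + wave_lip \<alpha> * norm (x - x'))"
        using c(2) W by (meson mult_left_mono order_trans less_imp_le)
      also have "\<dots> = (2 * W) * ?s + (W * wave_lip \<alpha>) * norm (x - x')"
        by (simp add: algebra_simps)
      also have "\<dots> \<le> C * ?s + C * norm (x - x')"
        using C s0 by (intro add_mono mult_right_mono) auto
      finally show ?thesis by (simp add: algebra_simps)
    qed
    then show "\<exists>r\<ge>0. \<bar>y - y'\<bar> \<le> reach_weight \<alpha> (abs_coord x) r \<and> r \<le> C * (norm (x - x') + ?s)"
      using r by auto
  qed
qed

section \<open>Comparison with the Carnot--Caratheodory distance\<close>

lemma ac_curve_on_bounded_linear: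
  assumes "ac_curve_on a b g" "bounded_linear f"
  shows "ac_curve_on a b (\<lambda>t. f (g t))"
proof -
  interpret bounded_linear f by fact
  obtain B where "\<And>x. norm (f x) \<le> norm x * B"
    using bounded by auto
  then have "norm (f x - f y) \<le> B * norm (x - y)" for x y
    by (metis diff mult.commute)
  with assms(1) show ?thesis by (rule ac_curve_on_compose_lipschitz)
qed

text \<open>Evaluated at \<open>real N * t - real m\<close> it is a ramp from 0 to 1 over the m-th
  of \<open>N\<close> equal time intervals.\<close>

definition unit_clamp :: "real \<Rightarrow> real" where
  "unit_clamp s = max 0 (min 1 s)"

lemma unit_clamp_lipschitz: "\<bar>unit_clamp s - unit_clamp t\<bar> \<le> \<bar>s - t\<bar>"
  by (auto simp: unit_clamp_def)

lemma unit_clamp_derivative: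
  assumes "s \<noteq> 0" "s \<noteq> 1"
  shows "(unit_clamp has_real_derivative (if 0 < s \<and> s < 1 then 1 else 0)) (at s)"
proof -
  consider "s < 0" | "0 < s" "s < 1" | "1 < s" using assms by linarith
  then show ?thesis
  proof cases
    case 1
    have "((\<lambda>_. 0) has_real_derivative 0) (at s)" by simp
    then have "(unit_clamp has_real_derivative 0) (at s)"
      by (rule has_field_derivative_transform_within_open[of _ _ _ "{..<0}"]) (use 1 in \<open>auto simp: unit_clamp_def\<close>)
    then show ?thesis using 1 by simp
  next
    case 2
    have "((\<lambda>t. t) has_real_derivative 1) (at s)" by simp
    then have "(unit_clamp has_real_derivative 1) (at s)"
      by (rule has_field_derivative_transform_within_open[of _ _ _ "{0<..<1}"]) (use 2 in \<open>auto simp: unit_clamp_def\<close>)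
    then show ?thesis using 2 by simp
  next
    case 3
    have "((\<lambda>_. 1) has_real_derivative 0) (at s)" by simp
    then have "(unit_clamp has_real_derivative 0) (at s)"
      by (rule has_field_derivative_transform_within_open[of _ _ _ "{1<..}"]) (use 3 in \<open>auto simp: unit_clamp_def\<close>)
    then show ?thesis using 3 by simp
  qed
qed

section \<open>Polygonal horizontal curves and the upper bound for the distance\<close>

lemma AE_lebesgue_not_in_finite:
  fixes S :: "'a::euclidean_space set"
  shows "finite S \<Longrightarrow> AE t in lebesgue. t \<notin> S"
  using negligible_finite[of S] by (intro AE_not_in) (simp add: negligible_iff_null_sets)

definition control_norm :: "('n::finite \<Rightarrow> real) \<Rightarrow> ('l::finite \<Rightarrow> real) \<Rightarrow> real" where
  "control_norm a b = sqrt ((\<Sum>i\<in>UNIV. (a i)\<^sup>2) + (\<Sum>j\<in>UNIV. (b j)\<^sup>2))"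

lemma control_norm_nonneg: "0 \<le> control_norm a b"
  by (simp add: control_norm_def sum_nonneg)

lemma control_norm_scale: "0 \<le> c \<Longrightarrow> control_norm (\<lambda>i. c * a i) (\<lambda>j. c * b j) = c * control_norm a b"
  by (simp add: control_norm_def power_mult_distrib sum_distrib_left[symmetric] distrib_left[symmetric] real_sqrt_mult)

lemma grushin_field_scale:
  "grushin_field alpha p (\<lambda>i. c * a i) (\<lambda>j. c * b j) = c *\<^sub>R grushin_field alpha p a b"
  by (simp add: grushin_field_def vec_eq_iff)

text \<open>Each segment must be an integral curve of constant controls, whose norm is then its
  length at unit duration. A positive \<open>N\<close> allows the unit interval to be split into
  \<open>N\<close> pieces.\<close>

definition polygonal_reach ::
  "('l::finite \<Rightarrow> 'n::finite \<Rightarrow> nat) \<Rightarrow> (real^'n) \<times> (real^'l) \<Rightarrow> (real^'n) \<times> (real^'l) \<Rightarrow> real \<Rightarrow> bool" where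
  "polygonal_reach alpha p q c \<longleftrightarrow> (\<exists>(N::nat) P a b. 0 < N \<and> P 0 = p \<and> P N = q \<and>
     (\<forall>i<N. \<forall>t\<in>{0..1}. grushin_field alpha (P i + t *\<^sub>R (P (Suc i) - P i)) (a i) (b i) = P (Suc i) - P i) \<and>
     (\<Sum>i<N. control_norm (a i) (b i)) \<le> c)"

lemma polygonal_reach_refl: "polygonal_reach alpha p p 0"
  unfolding polygonal_reach_def
  by (intro exI[of _ "1::nat"] exI[of _ "\<lambda>_. p"] exI[of _ "\<lambda>_ _. 0"])
    (simp add: control_norm_def grushin_field_def zero_prod_def vec_eq_iff)

lemma polygonal_reach_step:
  assumes "polygonal_reach alpha p q c"
    and step: "\<And>t. t \<in> {0..1} \<Longrightarrow> grushin_field alpha (q + t *\<^sub>R (q' - q)) a b = q' - q"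
    and "control_norm a b \<le> e"
  shows "polygonal_reach alpha p q' (c + e)"
proof -
  obtain N P A B where *: "P 0 = p" "P N = q"
     "\<forall>i<N. \<forall>t\<in>{0..1}. grushin_field alpha (P i + t *\<^sub>R (P (Suc i) - P i)) (A i) (B i) = P (Suc i) - P i"
     "(\<Sum>i<N. control_norm (A i) (B i)) \<le> c"
    using assms(1) unfolding polygonal_reach_def by auto
  define P' where "P' = P(Suc N := q')"
  define A' where "A' = A(N := a)"
  define B' where "B' = B(N := b)"
  have "P' 0 = p" "P' (Suc N) = q'" using * by (auto simp: P'_def)
  moreover have "\<forall>i<Suc N. \<forall>t\<in>{0..1}.
      grushin_field alpha (P' i + t *\<^sub>R (P' (Suc i) - P' i)) (A' i) (B' i) = P' (Suc i) - P' i"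
    using *(2,3) step by (auto simp: P'_def A'_def B'_def less_Suc_eq)
  moreover have "(\<Sum>i<Suc N. control_norm (A' i) (B' i)) \<le> c + e"
  proof -
    have "(\<Sum>i<N. control_norm (A' i) (B' i)) = (\<Sum>i<N. control_norm (A i) (B i))"
      by (intro sum.cong) (auto simp: A'_def B'_def)
    then show ?thesis using *(4) assms(3) by (simp add: A'_def B'_def)
  qed
  ultimately show ?thesis
    unfolding polygonal_reach_def by blast
qed

lemma polygonal_reach_mono:
  assumes "polygonal_reach alpha p q c" "c \<le> c'"
  shows "polygonal_reach alpha p q c'"
proof -
  obtain N P a b where "0 < N" "P 0 = p" "P N = q"
     "\<forall>i<N. \<forall>t\<in>{0..1}. grushin_field alpha (P i + t *\<^sub>R (P (Suc i) - P i)) (a i) (b i) = P (Suc i) - P i"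
     "(\<Sum>i<N. control_norm (a i) (b i)) \<le> c"
    using assms(1) unfolding polygonal_reach_def by auto
  with order_trans[OF this(5) assms(2)] show ?thesis
    unfolding polygonal_reach_def by blast
qed

text \<open>Segment \<open>m\<close> is run through during the m-th of \<open>N\<close> equal time
  intervals with its controls multiplied by \<open>N\<close>, so each length is preserved.\<close>

lemma cc_dist_le_polygonal_reach:
  fixes alpha :: "'l::finite \<Rightarrow> 'n::finite \<Rightarrow> nat"
  assumes "polygonal_reach alpha p q c"
  shows "cc_dist alpha p q \<le> ennreal c"
proof -
  obtain N P a b where N: "0 < N" and P: "P 0 = p" "P N = q"
     and field': "\<forall>i<N. \<forall>t\<in>{0..1}.
        grushin_field alpha (P i + t *\<^sub>R (P (Suc i) - P i)) (a i) (b i) = P (Suc i) - P i"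
     and len: "(\<Sum>i<N. control_norm (a i) (b i)) \<le> c"
    using assms unfolding polygonal_reach_def by auto
  define V where "V m = P (Suc m) - P m" for m
  \<comment> \<open>A sum of ramps is visibly Lipschitz and differentiable off the finite set
    \<open>D\<close> of break points.\<close>
  define g where "g t = P 0 + (\<Sum>m<N. unit_clamp (real N * t - real m) *\<^sub>R V m)" for t
  define idx where "idx t = nat \<lfloor>real N * t\<rfloor>" for t
  define A where "A t i = real N * a (idx t) i" for t i
  define B where "B t j = real N * b (idx t) j" for t j
  define D where "D = (\<lambda>m. real m / real N) ` {..N}"
  have field: "grushin_field alpha (P i + t *\<^sub>R V i) (a i) (b i) = V i" if "i < N" "t \<in> {0..1}" for i t
    using field' that by (auto simp: V_def)
  have idx: "idx t < N" "real (idx t) < real N * t" "real N * t < real (idx t) + 1"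
    if t: "t \<in> {0..1}" "t \<notin> D" for t
  proof -
    have nonneg: "0 \<le> real N * t" using t by simp
    have le: "real (idx t) \<le> real N * t" and lt: "real N * t < real (idx t) + 1"
      using nonneg unfolding idx_def by linarith+
    have "real N * t \<le> real N" using t by (simp add: mult_left_le)
    with le have "real (idx t) \<le> real N" by linarith
    then have leN: "idx t \<le> N" by simp
    have ne: "real (idx t) \<noteq> real N * t"
    proof
      assume "real (idx t) = real N * t"
      then have "t = real (idx t) / real N" using N by simp
      then show False using t(2) leN by (auto simp: D_def)
    qed
    with le show lt': "real (idx t) < real N * t" by simp
    show "real N * t < real (idx t) + 1" by (rule lt)
    from lt' \<open>real N * t \<le> real N\<close> have "real (idx t) < real N" by linarith
    then show "idx t < N" by simp
  qed
  have g_idx: "g t = P (idx t) + (real N * t - real (idx t)) *\<^sub>R V (idx t)" if t: "t \<in> {0..1}" "t \<notin> D" for t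
  proof -
    let ?i = "idx t"
    note i = idx[OF t]
    have one: "unit_clamp (real N * t - real m) = 1" if "m < ?i" for m
    proof -
      have "real m + 1 \<le> real ?i" using that by simp
      then show ?thesis using i(2) by (simp add: unit_clamp_def)
    qed
    have zero: "unit_clamp (real N * t - real m) = 0" if "?i < m" for m
    proof -
      have "real ?i + 1 \<le> real m" using that by simp
      then show ?thesis using i(3) by (simp add: unit_clamp_def)
    qed
    have "(\<Sum>m<N. unit_clamp (real N * t - real m) *\<^sub>R V m) = (\<Sum>m<Suc ?i. unit_clamp (real N * t - real m) *\<^sub>R V m)"
      using i(1) zero by (intro sum.mono_neutral_right) auto
    also have "\<dots> = (\<Sum>m<?i. V m) + (real N * t - real ?i) *\<^sub>R V ?i"
      using one i by (simp add: unit_clamp_def)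
    also have "(\<Sum>m<?i. V m) = P ?i - P 0"
      unfolding V_def by (rule sum_lessThan_telescope)
    finally show ?thesis by (simp add: g_def)
  qed
  have deriv: "(g has_vector_derivative real N *\<^sub>R V (idx t)) (at t within {0..1})"
    if t: "t \<in> {0..1}" "t \<notin> D" for t
  proof -
    let ?i = "idx t"
    note i = idx[OF t]
    have "((\<lambda>s. unit_clamp (real N * s - real m)) has_real_derivative (if m = ?i then real N else 0)) (at t)" for m
    proof -
      have m: "m < ?i \<Longrightarrow> real m + 1 \<le> real ?i" "?i < m \<Longrightarrow> real ?i + 1 \<le> real m" by auto
      have "(unit_clamp has_real_derivative (if m = ?i then 1 else 0)) (at (real N * t - real m))"
        using unit_clamp_derivative[of "real N * t - real m"] i m
        by (cases m ?i rule: linorder_cases) auto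
      moreover have "((\<lambda>s. real N * s - real m) has_real_derivative real N) (at t)"
        by (auto intro!: derivative_eq_intros)
      ultimately show ?thesis
        using DERIV_chain2[of unit_clamp _ "\<lambda>s. real N * s - real m"] by fastforce
    qed
    then have "((\<lambda>s. unit_clamp (real N * s - real m) *\<^sub>R V m) has_vector_derivative
        (if m = ?i then real N else 0) *\<^sub>R V m) (at t)" for m
      using has_vector_derivative_scaleR[OF _ has_vector_derivative_const] by fastforce
    then have "(g has_vector_derivative 0 + (\<Sum>m<N. (if m = ?i then real N else 0) *\<^sub>R V m)) (at t)"
      unfolding g_def by (intro has_vector_derivative_add has_vector_derivative_const has_vector_derivative_sum)
    also have "0 + (\<Sum>m<N. (if m = ?i then real N else 0) *\<^sub>R V m) = real N *\<^sub>R V ?i"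
      using i(1) by (simp add: if_distrib[of "\<lambda>c. c *\<^sub>R _"] cong: if_cong)
    finally show ?thesis by (rule has_vector_derivative_at_within)
  qed
  have AE_D: "AE t in lebesgue. t \<notin> D"
    by (rule AE_lebesgue_not_in_finite) (simp add: D_def)
  have "grushin_admissible alpha p q g A B"
    unfolding grushin_admissible_def
  proof (intro conjI)
    have "unit_clamp (real N * 0 - real m) = 0" for m by (simp add: unit_clamp_def)
    then show "g 0 = p" using P by (simp add: g_def)
    have "unit_clamp (real N * 1 - real m) = 1" if "m < N" for m
    proof -
      have "real m + 1 \<le> real N" using that by simp
      then show ?thesis by (simp add: unit_clamp_def)
    qed
    then have "g 1 = P 0 + (\<Sum>m<N. V m)" by (simp add: g_def)
    also have "\<dots> = q" using P sum_lessThan_telescope[of P N] by (simp add: V_def)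
    finally show "g 1 = q" .
    show "ac_curve_on 0 1 g"
    proof (rule lipschitz_imp_ac_curve_on)
      fix s t :: real
      have "norm (g s - g t)
          = norm (\<Sum>m<N. (unit_clamp (real N * s - real m) - unit_clamp (real N * t - real m)) *\<^sub>R V m)"
        by (simp add: g_def sum_subtractf scaleR_left_diff_distrib)
      also have "\<dots> \<le> (\<Sum>m<N. (real N * \<bar>s - t\<bar>) * norm (V m))"
      proof (rule sum_norm_le)
        fix m
        have "\<bar>unit_clamp (real N * s - real m) - unit_clamp (real N * t - real m)\<bar> \<le> \<bar>real N * s - real N * t\<bar>"
          using unit_clamp_lipschitz[of "real N * s - real m" "real N * t - real m"] by simp
        also have "\<dots> = real N * \<bar>s - t\<bar>"
          by (simp add: right_diff_distrib[symmetric] abs_mult)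
        finally show "norm ((unit_clamp (real N * s - real m) - unit_clamp (real N * t - real m)) *\<^sub>R V m)
            \<le> (real N * \<bar>s - t\<bar>) * norm (V m)"
          by (simp add: mult_right_mono)
      qed
      also have "\<dots> = (\<Sum>m<N. real N * norm (V m)) * \<bar>s - t\<bar>"
        unfolding sum_distrib_right by (intro sum.cong) auto
      finally show "norm (g s - g t) \<le> (\<Sum>m<N. real N * norm (V m)) * \<bar>s - t\<bar>" .
    qed
    show "AE t in lebesgue. t \<in> {0..1} \<longrightarrow>
        (g has_vector_derivative grushin_field alpha (g t) (A t) (B t)) (at t within {0..1})"
      using AE_D
    proof (rule eventually_mono, intro impI)
      fix t assume t: "t \<notin> D" "t \<in> {0..1::real}"
      have "grushin_field alpha (g t) (a (idx t)) (b (idx t)) = V (idx t)"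
        unfolding g_idx[OF t(2,1)] using idx[OF t(2,1)] by (intro field) auto
      then have "grushin_field alpha (g t) (A t) (B t) = real N *\<^sub>R V (idx t)"
        unfolding A_def B_def by (simp add: grushin_field_scale)
      then show "(g has_vector_derivative grushin_field alpha (g t) (A t) (B t)) (at t within {0..1})"
        using deriv[OF t(2,1)] by simp
    qed
  qed
  then have "cc_dist alpha p q \<le> control_length A B"
    unfolding cc_dist_def by (intro INF_lower2[of "(g, A, B)"]) auto
  \<comment> \<open>Away from \<open>D\<close> the integrand is one of the summands, so it is
    bounded by a step function whose integral is explicit.\<close>
  also have "\<dots> \<le> (\<integral>\<^sup>+ t. (\<Sum>i<N. ennreal (real N * control_norm (a i) (b i)) *
      indicator {real i / real N..(real i + 1) / real N} t) \<partial>lebesgue)"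
    unfolding control_length_def
  proof (rule nn_integral_mono_AE)
    show "AE t in lebesgue.
      ennreal (sqrt ((\<Sum>i\<in>UNIV. (A t i)\<^sup>2) + (\<Sum>j\<in>UNIV. (B t j)\<^sup>2))) * indicator {0..1} t
      \<le> (\<Sum>i<N. ennreal (real N * control_norm (a i) (b i)) * indicator {real i / real N..(real i + 1) / real N} t)"
      using AE_D
    proof (rule eventually_mono)
      fix t assume t: "t \<notin> D"
      let ?f = "\<lambda>i. ennreal (real N * control_norm (a i) (b i)) * indicator {real i / real N..(real i + 1) / real N} t"
      show "ennreal (sqrt ((\<Sum>i\<in>UNIV. (A t i)\<^sup>2) + (\<Sum>j\<in>UNIV. (B t j)\<^sup>2))) * indicator {0..1} t \<le> sum ?f {..<N}"
      proof (cases "t \<in> {0..1}")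
        case True
        note i = idx[OF True t]
        have "t \<in> {real (idx t) / real N..(real (idx t) + 1) / real N}"
          using i N by (simp add: field_simps)
        moreover have "sqrt ((\<Sum>i\<in>UNIV. (A t i)\<^sup>2) + (\<Sum>j\<in>UNIV. (B t j)\<^sup>2))
            = real N * control_norm (a (idx t)) (b (idx t))"
          using control_norm_scale[of "real N" "a (idx t)" "b (idx t)"]
          by (simp add: control_norm_def A_def B_def)
        ultimately have "ennreal (sqrt ((\<Sum>i\<in>UNIV. (A t i)\<^sup>2) + (\<Sum>j\<in>UNIV. (B t j)\<^sup>2))) * indicator {0..1} t = ?f (idx t)"
          using True by simp
        also have "\<dots> \<le> sum ?f {..<N}"
          using i(1) by (intro member_le_sum) auto
        finally show ?thesis .
      qed simp
    qed
  qed
  also have "\<dots> = (\<Sum>i<N. \<integral>\<^sup>+ t. ennreal (real N * control_norm (a i) (b i)) *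
      indicator {real i / real N..(real i + 1) / real N} t \<partial>lebesgue)"
    by (intro nn_integral_sum borel_measurable_times_ennreal borel_measurable_const borel_measurable_indicator) auto
  also have "\<dots> = (\<Sum>i<N. ennreal (control_norm (a i) (b i)))"
  proof (rule sum.cong[OF refl])
    fix i
    have le: "real i / real N \<le> (real i + 1) / real N"
      using N by (simp add: divide_right_mono)
    have "(real i + 1) / real N - real i / real N = 1 / real N"
      by (simp add: diff_divide_distrib[symmetric])
    then have "emeasure lebesgue {real i / real N..(real i + 1) / real N} = ennreal (1 / real N)"
      using le by simp
    then have "(\<integral>\<^sup>+ t. ennreal (real N * control_norm (a i) (b i)) *
      indicator {real i / real N..(real i + 1) / real N} t \<partial>lebesgue)
        = ennreal (real N * control_norm (a i) (b i)) * ennreal (1 / real N)"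
      by (subst nn_integral_cmult_indicator) auto
    also have "\<dots> = ennreal (control_norm (a i) (b i))"
      using N control_norm_nonneg[of "a i" "b i"] by (simp add: ennreal_mult[symmetric])
    finally show "(\<integral>\<^sup>+ t. ennreal (real N * control_norm (a i) (b i)) *
      indicator {real i / real N..(real i + 1) / real N} t \<partial>lebesgue) = ennreal (control_norm (a i) (b i))" .
  qed
  also have "\<dots> = ennreal (\<Sum>i<N. control_norm (a i) (b i))"
    by (intro sum_ennreal control_norm_nonneg)
  also have "\<dots> \<le> ennreal c"
    by (intro ennreal_leI len)
  finally show ?thesis .
qed

lemma abs_monom_pow: "\<bar>monom_pow x a\<bar> = (\<Prod>i\<in>UNIV. \<bar>x $ i\<bar> ^ a i)"
  by (simp add: monom_pow_def abs_prod power_abs)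

lemma polygonal_reach_horizontal:
  fixes alpha :: "'l::finite \<Rightarrow> 'n::finite \<Rightarrow> nat"
  assumes "polygonal_reach alpha p (x, y) c"
  shows "polygonal_reach alpha p (x', y) (c + norm (x' - x))"
proof (rule polygonal_reach_step[OF assms])
  show "grushin_field alpha ((x, y) + t *\<^sub>R ((x', y) - (x, y))) (\<lambda>i. (x' - x) $ i) (\<lambda>j. 0) = (x', y) - (x, y)" for t
    by (simp add: grushin_field_def vec_eq_iff)
  show "control_norm (\<lambda>i. (x' - x) $ i) (\<lambda>j::'l. 0) \<le> norm (x' - x)"
    by (simp add: control_norm_def norm_vec_def L2_set_def)
qed

text \<open>To move \<open>y\<^sub>j\<close> cheaply, first push every \<open>x\<^sub>i\<close> a distance \<open>r\<close> away from \<open>0\<close>.\<close>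
lemma polygonal_reach_vertical:
  fixes alpha :: "'l::finite \<Rightarrow> 'n::finite \<Rightarrow> nat"
  assumes reach: "polygonal_reach alpha p (x, y) c" and "0 \<le> r"
    and yj: "\<bar>y' $ j - y $ j\<bar> \<le> reach_weight (alpha j) (abs_coord x) r"
    and other: "\<And>k. k \<noteq> j \<Longrightarrow> y' $ k = y $ k"
  shows "polygonal_reach alpha p (x, y') (c + (2 * real CARD('n) + 1) * r)"
proof -
  \<comment> \<open>Moving each coordinate away from 0 gives it absolute value
    \<open>\<bar>x $ i\<bar> + r\<close>, so the monomial at \<open>w\<close> dominates the product
    in the weight.\<close>
  define w where "w = (\<chi> i. if 0 \<le> x $ i then x $ i + r else x $ i - r)"
  define \<delta> where "\<delta> = y' $ j - y $ j"
  define \<mu> where "\<mu> = monom_pow w (alpha j)"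
  have wi: "\<bar>w $ i\<bar> = \<bar>x $ i\<bar> + r" for i using \<open>0 \<le> r\<close> by (simp add: w_def)
  have "norm (w - x) \<le> (\<Sum>i\<in>UNIV. \<bar>(w - x) $ i\<bar>)" by (rule norm_le_l1_cart)
  also have "\<dots> = (\<Sum>i\<in>(UNIV :: 'n set). r)"
    using \<open>0 \<le> r\<close> by (intro sum.cong) (auto simp: w_def)
  also have "\<dots> = real CARD('n) * r" by simp
  finally have wx: "norm (w - x) \<le> real CARD('n) * r" .
  have prod_le: "(\<Prod>i\<in>UNIV. max \<bar>x $ i\<bar> r ^ alpha j i) \<le> \<bar>\<mu>\<bar>"
    unfolding \<mu>_def abs_monom_pow wi using \<open>0 \<le> r\<close> by (intro prod_mono) (auto intro!: power_mono)
  have \<delta>\<mu>: "\<bar>\<delta>\<bar> \<le> r * \<bar>\<mu>\<bar>"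
    using yj mult_left_mono[OF prod_le \<open>0 \<le> r\<close>] unfolding \<delta>_def reach_weight_def by linarith
  \<comment> \<open>If \<open>\<mu> = 0\<close>, no displacement is required, and the control
    \<open>\<delta> / \<mu>\<close> is 0 by the convention for division.\<close>
  then have nz: "\<mu> \<noteq> 0 \<or> \<delta> = 0" by auto
  have b: "\<bar>\<delta> / \<mu>\<bar> \<le> r"
    using \<delta>\<mu> nz \<open>0 \<le> r\<close> by (cases "\<mu> = 0") (auto simp: field_simps)
  have 1: "polygonal_reach alpha p (w, y) (c + norm (w - x))"
    by (rule polygonal_reach_horizontal[OF reach])
  have 2: "polygonal_reach alpha p (w, y') (c + norm (w - x) + r)"
  proof (rule polygonal_reach_step[OF 1])
    fix t :: real
    have "(if k = j then monom_pow w (alpha k) * (\<delta> / \<mu>) else 0) = (y' - y) $ k" for k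
      using nz other[of k] by (auto simp: \<mu>_def \<delta>_def)
    then show "grushin_field alpha ((w, y) + t *\<^sub>R ((w, y') - (w, y))) (\<lambda>i. 0) (\<lambda>k. if k = j then \<delta> / \<mu> else 0)
        = (w, y') - (w, y)"
      by (simp add: grushin_field_def vec_eq_iff if_distrib cong: if_cong)
    have "(\<Sum>k\<in>UNIV. (if k = j then \<delta> / \<mu> else 0)\<^sup>2) = (\<delta> / \<mu>)\<^sup>2"
      by (simp add: if_distrib[of "\<lambda>c. c\<^sup>2"] cong: if_cong)
    then show "control_norm (\<lambda>i::'n. 0) (\<lambda>k. if k = j then \<delta> / \<mu> else 0) \<le> r"
      using b by (simp add: control_norm_def)
  qed
  \<comment> \<open>The way back to \<open>x\<close> costs as much as the way out: twice
    \<open>CARD('n') * r\<close>, plus \<open>r\<close> for the vertical move.\<close>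
  have "polygonal_reach alpha p (x, y') (c + norm (w - x) + r + norm (x - w))"
    by (rule polygonal_reach_horizontal[OF 2])
  then show ?thesis
    by (rule polygonal_reach_mono) (use wx in \<open>simp add: norm_minus_commute[of x w] algebra_simps\<close>)
qed

text \<open>The heights are adjusted one at a time, each time returning to \<open>x\<close>, so that
  all weights are taken at the same point; the move from \<open>x\<close> to \<open>x'\<close> comes
  last.\<close>

lemma cc_dist_upper:
  fixes alpha :: "'l::finite \<Rightarrow> 'n::finite \<Rightarrow> nat"
  assumes "\<And>j. 0 \<le> r j" and "\<And>j. \<bar>y' $ j - y $ j\<bar> \<le> reach_weight (alpha j) (abs_coord x) (r j)"
  shows "cc_dist alpha (x, y) (x', y')
    \<le> ennreal (norm (x' - x) + (2 * real CARD('n) + 1) * (\<Sum>j\<in>UNIV. r j))"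
proof -
  define Y where "Y S = (\<chi> j. if j \<in> S then y' $ j else y $ j)" for S
  have "polygonal_reach alpha (x, y) (x, Y S) ((2 * real CARD('n) + 1) * (\<Sum>j\<in>S. r j))" if "finite S" for S
    using that
  proof (induction S rule: finite_induct)
    case empty
    have "Y {} = y" by (simp add: Y_def vec_eq_iff)
    then show ?case using polygonal_reach_refl[of alpha "(x, y)"] by simp
  next
    case (insert j S)
    have "polygonal_reach alpha (x, y) (x, Y (insert j S))
        ((2 * real CARD('n) + 1) * (\<Sum>j\<in>S. r j) + (2 * real CARD('n) + 1) * r j)"
    proof (rule polygonal_reach_vertical[OF insert.IH])
      show "0 \<le> r j" by (rule assms)
      show "\<bar>Y (insert j S) $ j - Y S $ j\<bar> \<le> reach_weight (alpha j) (abs_coord x) (r j)"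
        using assms(2)[of j] insert.hyps by (simp add: Y_def)
      show "Y (insert j S) $ k = Y S $ k" if "k \<noteq> j" for k
        using that by (simp add: Y_def)
    qed
    then show ?case
      using insert.hyps by (simp add: distrib_left add.commute)
  qed
  from polygonal_reach_horizontal[OF this[of UNIV], of x'] have
    "polygonal_reach alpha (x, y) (x', y') ((2 * real CARD('n) + 1) * (\<Sum>j\<in>UNIV. r j) + norm (x' - x))"
    by (simp add: Y_def)
  then show ?thesis
    by (subst add.commute) (rule cc_dist_le_polygonal_reach)
qed

text \<open>A curve shorter than \<open>R\<close> keeps its first component within \<open>R\<close>
  of \<open>x\<close>, which bounds the monomials along it and hence the vertical speed. The strict
  hypothesis yields an actual curve, as the infimum need not be attained.\<close>

lemma cc_dist_lower:
  fixes alpha :: "'l::finite \<Rightarrow> 'n::finite \<Rightarrow> nat"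
  assumes less: "cc_dist alpha (x, y) (x', y') < ennreal R"
  shows "norm (x' - x) \<le> R"
    and "\<bar>y' $ j - y $ j\<bar> \<le> reach_weight (alpha j) (abs_coord x) (2 ^ sum (alpha j) UNIV * R)"
proof -
  obtain g a b where adm: "grushin_admissible alpha (x, y) (x', y') g a b" and len: "control_length a b < ennreal R"
    using less unfolding cc_dist_def by (auto simp: INF_less_iff)
  have R: "0 < R"
    using len by (cases "0 < R") (auto simp: ennreal_neg)
  define h where "h t = control_norm (a t) (b t)" for t
  have g: "g 0 = (x, y)" "g 1 = (x', y')" and ac: "ac_curve_on 0 1 g" and
    deriv: "AE t in lebesgue. t \<in> {0..1} \<longrightarrow>
        (g has_vector_derivative grushin_field alpha (g t) (a t) (b t)) (at t within {0..1})"
    using adm by (auto simp: grushin_admissible_def)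
  have int: "(\<integral>\<^sup>+ t\<in>{0..1}. ennreal (h t) \<partial>lebesgue) \<le> ennreal R"
    using len by (simp add: control_length_def h_def control_norm_def)
  \<comment> \<open>The horizontal and the vertical bound are both integrations of a linear image of
    the velocity. Arbitrary end times \<open>s\<close> are needed to confine the whole curve before
    the monomials are estimated.\<close>
  have estimate: "norm (f (g s) - f (g 0)) \<le> R"
    if s: "s \<in> {0..1}" and f: "bounded_linear f"
      and bound: "\<And>t. t \<in> {0..s} \<Longrightarrow> norm (f (grushin_field alpha (g t) (a t) (b t))) \<le> h t"
    for s and f :: "(real^'n) \<times> (real^'l) \<Rightarrow> 'z::euclidean_space"
  proof -
    have "ennreal (norm (f (g s) - f (g 0))) \<le> (\<integral>\<^sup>+ t\<in>{0..s}. ennreal (h t) \<partial>lebesgue)"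
    proof (rule ac_curve_norm_diff_le[where g = "\<lambda>t. f (g t)" and g' = "\<lambda>t. f (grushin_field alpha (g t) (a t) (b t))"])
      have "ac_curve_on 0 s g"
        by (rule ac_curve_on_subinterval[OF ac]) (use s in auto)
      then show "ac_curve_on 0 s (\<lambda>t. f (g t))"
        using f by (rule ac_curve_on_bounded_linear)
      show "AE t in lebesgue. t \<in> {0..s} \<longrightarrow>
        ((\<lambda>t. f (g t)) has_vector_derivative f (grushin_field alpha (g t) (a t) (b t))) (at t within {0..s}) \<and>
        norm (f (grushin_field alpha (g t) (a t) (b t))) \<le> h t"
        using deriv
      proof (rule eventually_mono, intro impI conjI)
        fix t assume *: "t \<in> {0..1} \<longrightarrow>
          (g has_vector_derivative grushin_field alpha (g t) (a t) (b t)) (at t within {0..1})" and t: "t \<in> {0..s}"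
        then have "(g has_vector_derivative grushin_field alpha (g t) (a t) (b t)) (at t within {0..1})"
          using s by auto
        then have "((\<lambda>t. f (g t)) has_vector_derivative f (grushin_field alpha (g t) (a t) (b t))) (at t within {0..1})"
          by (rule bounded_linear.has_vector_derivative[OF f])
        then show "((\<lambda>t. f (g t)) has_vector_derivative f (grushin_field alpha (g t) (a t) (b t))) (at t within {0..s})"
          by (rule has_vector_derivative_within_subset) (use s in auto)
        show "norm (f (grushin_field alpha (g t) (a t) (b t))) \<le> h t"
          by (rule bound[OF t])
      qed
    qed (use s in auto)
    also have "\<dots> \<le> (\<integral>\<^sup>+ t\<in>{0..1}. ennreal (h t) \<partial>lebesgue)"
      using s by (intro nn_integral_mono) (auto simp: indicator_def)
    also have "\<dots> \<le> ennreal R" by (rule int)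
    finally show ?thesis using R by simp
  qed
  have horizontal: "norm (fst (g s) - x) \<le> R" if "s \<in> {0..1}" for s
  proof -
    have "norm (fst (grushin_field alpha (g t) (a t) (b t))) \<le> h t" for t
      by (simp add: grushin_field_def h_def control_norm_def norm_vec_def L2_set_def sum_nonneg)
    then show ?thesis
      using estimate[OF that bounded_linear_fst] that g by simp
  qed
  from horizontal[of 1] g show "norm (x' - x) \<le> R" by simp
  \<comment> \<open>A bound for the j-th monomial along the curve; division by it makes the vertical
    speed at most \<open>h\<close>.\<close>
  define m where "m = (\<Prod>i\<in>UNIV. (\<bar>x $ i\<bar> + R) ^ alpha j i)"
  have m: "0 < m" unfolding m_def using R by (intro prod_pos) (auto intro!: zero_less_power add_nonneg_pos)
  define f where "f u = snd u $ j / m" for u :: "(real^'n) \<times> (real^'l)"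
  have "bounded_linear (\<lambda>u :: (real^'n) \<times> (real^'l). snd u $ j)"
    by (rule bounded_linear_compose[OF bounded_linear_vec_nth bounded_linear_snd])
  then have f: "bounded_linear f"
    unfolding f_def by (rule bounded_linear_compose[OF bounded_linear_divide])
  have "norm (f (grushin_field alpha (g t) (a t) (b t))) \<le> h t" if t: "t \<in> {0..1}" for t
  proof -
    have "\<bar>fst (g t) $ i\<bar> \<le> \<bar>x $ i\<bar> + R" for i
      using horizontal[OF t] component_le_norm_cart[of "fst (g t) - x" i] by simp
    then have "\<bar>monom_pow (fst (g t)) (alpha j)\<bar> \<le> m"
      unfolding abs_monom_pow m_def by (intro prod_mono) (auto intro!: power_mono)
    then have "\<bar>monom_pow (fst (g t)) (alpha j)\<bar> * \<bar>b t j\<bar> / m \<le> \<bar>b t j\<bar>"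
      using m mult_right_mono[of "\<bar>monom_pow (fst (g t)) (alpha j)\<bar>" m "\<bar>b t j\<bar>"]
      by (simp add: field_simps)
    moreover have "\<bar>b t j\<bar> \<le> h t"
    proof -
      have "(b t j)\<^sup>2 \<le> (\<Sum>j\<in>UNIV. (b t j)\<^sup>2)" by (intro member_le_sum) auto
      also have "\<dots> \<le> (\<Sum>i\<in>UNIV. (a t i)\<^sup>2) + (\<Sum>j\<in>UNIV. (b t j)\<^sup>2)" by (simp add: sum_nonneg)
      finally show ?thesis
        unfolding h_def control_norm_def by (intro real_le_rsqrt) simp
    qed
    ultimately show ?thesis
      using m by (simp add: f_def grushin_field_def abs_mult)
  qed
  from estimate[OF _ f this, of 1] have "\<bar>(y' $ j - y $ j) / m\<bar> \<le> R"
    using g by (simp add: f_def diff_divide_distrib)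
  then have "\<bar>y' $ j - y $ j\<bar> \<le> R * m"
    using m by (simp add: field_simps)
  \<comment> \<open>Each factor 2 leaves the product, and the resulting power of 2 is absorbed into
    the scale by \<open>reach_weight_scale_ge\<close>.\<close>
  also have "m \<le> (\<Prod>i\<in>UNIV. (2 * max \<bar>x $ i\<bar> R) ^ alpha j i)"
  proof -
    have "\<bar>x $ i\<bar> + R \<le> 2 * max \<bar>x $ i\<bar> R" "0 \<le> \<bar>x $ i\<bar> + R" for i
      using R by linarith+
    then show ?thesis
      unfolding m_def by (intro prod_mono conjI power_mono zero_le_power)
  qed
  also have "\<dots> = 2 ^ sum (alpha j) UNIV * (\<Prod>i\<in>UNIV. max \<bar>x $ i\<bar> R ^ alpha j i)"
    by (simp add: power_mult_distrib prod.distrib power_sum)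
  finally have "\<bar>y' $ j - y $ j\<bar> \<le> 2 ^ sum (alpha j) UNIV * reach_weight (alpha j) (abs_coord x) R"
    using R by (simp add: reach_weight_def mult_ac)
  also have "\<dots> \<le> reach_weight (alpha j) (abs_coord x) (2 ^ sum (alpha j) UNIV * R)"
    using R by (intro reach_weight_scale_ge) auto
  finally show "\<bar>y' $ j - y $ j\<bar> \<le> reach_weight (alpha j) (abs_coord x) (2 ^ sum (alpha j) UNIV * R)" .
qed

text \<open>The functions become the coordinates of the embedding; on \<open>N\<close> coordinates
  the sum of absolute differences and the Euclidean norm agree up to the factor
  \<open>N\<close>.\<close>

lemma bi_lipschitz_embeddable_of_finite_family:
  fixes \<Omega> :: "('p \<Rightarrow> real) set"
  assumes fin: "finite \<Omega>" and "0 < C"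
    and upper: "\<And>\<omega> p q. \<omega> \<in> \<Omega> \<Longrightarrow> ennreal \<bar>\<omega> p - \<omega> q\<bar> \<le> ennreal C * d p q"
    and lower: "\<And>p q. d p q \<le> ennreal (C * (\<Sum>\<omega>\<in>\<Omega>. \<bar>\<omega> p - \<omega> q\<bar>))"
  shows "bi_lipschitz_embeddable_in_euclidean d"
proof -
  define N where "N = card \<Omega>"
  obtain e where e: "bij_betw e {..<N} \<Omega>"
    using ex_bij_betw_nat_finite[OF fin] by (auto simp: N_def atLeast0LessThan)
  define f where "f p i = e i p" for p i
  \<comment> \<open>The summand 1 keeps the constant positive when the family is empty.\<close>
  define C' where "C' = C * (real N + 1)"
  have C': "0 < C'" "C * real N \<le> C'" using \<open>0 < C\<close> by (auto simp: C'_def)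
  have L2: "eucl_dist N (f p) (f q) = L2_set (\<lambda>i. e i p - e i q) {..<N}" for p q
    by (simp add: eucl_dist_def L2_set_def f_def)
  have sum: "(\<Sum>i<N. \<bar>e i p - e i q\<bar>) = (\<Sum>\<omega>\<in>\<Omega>. \<bar>\<omega> p - \<omega> q\<bar>)" for p q
    using sum.reindex_bij_betw[OF e, of "\<lambda>\<omega>. \<bar>\<omega> p - \<omega> q\<bar>"] by simp
  have "ennreal (eucl_dist N (f p) (f q)) \<le> ennreal C' * d p q" for p q
  proof -
    have "ennreal (eucl_dist N (f p) (f q)) \<le> ennreal (\<Sum>i<N. \<bar>e i p - e i q\<bar>)"
      unfolding L2 by (intro ennreal_leI L2_set_le_sum_abs)
    also have "\<dots> = (\<Sum>i<N. ennreal \<bar>e i p - e i q\<bar>)"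
      by (rule sum_ennreal[symmetric]) simp
    also have "\<dots> \<le> (\<Sum>i<N. ennreal C * d p q)"
      using e by (intro sum_mono upper) (auto simp: bij_betw_def)
    also have "\<dots> = ennreal (real N * C) * d p q"
      using \<open>0 < C\<close> by (simp add: ennreal_mult ennreal_of_nat_eq_real_of_nat mult.assoc)
    also have "\<dots> \<le> ennreal C' * d p q"
      using C' by (intro mult_right_mono ennreal_leI) (auto simp: mult.commute)
    finally show ?thesis .
  qed
  moreover have "d p q \<le> ennreal C' * ennreal (eucl_dist N (f p) (f q))" for p q
  proof -
    have "(\<Sum>i<N. \<bar>e i p - e i q\<bar>) \<le> (\<Sum>i<N. eucl_dist N (f p) (f q))"
    proof (rule sum_mono)
      fix i assume i: "i \<in> {..<N}"
      have "\<bar>e i p - e i q\<bar> \<le> L2_set (\<lambda>i. \<bar>e i p - e i q\<bar>) {..<N}"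
        using i by (intro member_le_L2_set) auto
      then show "\<bar>e i p - e i q\<bar> \<le> eucl_dist N (f p) (f q)"
        by (simp add: L2 L2_set_def)
    qed
    then have "(\<Sum>\<omega>\<in>\<Omega>. \<bar>\<omega> p - \<omega> q\<bar>) \<le> real N * eucl_dist N (f p) (f q)"
      unfolding sum by simp
    then have "C * (\<Sum>\<omega>\<in>\<Omega>. \<bar>\<omega> p - \<omega> q\<bar>) \<le> C * (real N * eucl_dist N (f p) (f q))"
      using \<open>0 < C\<close> by (intro mult_left_mono) auto
    moreover have nonneg: "0 \<le> eucl_dist N (f p) (f q)"
      unfolding L2 by (rule L2_set_nonneg)
    then have "C * real N * eucl_dist N (f p) (f q) \<le> C' * eucl_dist N (f p) (f q)"
      by (rule mult_right_mono[OF C'(2)])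
    ultimately have "C * (\<Sum>\<omega>\<in>\<Omega>. \<bar>\<omega> p - \<omega> q\<bar>) \<le> C' * eucl_dist N (f p) (f q)"
      by (simp only: mult.assoc)
    then have "ennreal (C * (\<Sum>\<omega>\<in>\<Omega>. \<bar>\<omega> p - \<omega> q\<bar>)) \<le> ennreal C' * ennreal (eucl_dist N (f p) (f q))"
      using C' nonneg by (simp add: ennreal_mult[symmetric] ennreal_leI)
    then show ?thesis by (rule order_trans[OF lower])
  qed
  ultimately show ?thesis
    unfolding bi_lipschitz_embeddable_in_euclidean_def using C'(1) by blast
qed

section \<open>The embedding\<close>

theorem theorem4p10:
  fixes alpha :: "'l::finite \<Rightarrow> 'n::finite \<Rightarrow> nat" and k :: nat
  assumes "\<And>j. (\<Sum>i\<in>UNIV. alpha j i) = k"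
  shows "bi_lipschitz_embeddable_in_euclidean (cc_dist alpha)"
proof -
  have "\<forall>j. \<exists>PC. line_embedding (alpha j) (fst PC) (snd PC)"
    using ex_line_embedding by (metis fst_conv snd_conv)
  from choice[OF this] obtain PC where PC: "\<And>j. line_embedding (alpha j) (fst (PC j)) (snd (PC j))"
    by auto
  define \<Phi> where "\<Phi> j = fst (PC j)" for j
  define c where "c j = snd (PC j)" for j
  have fin: "finite (\<Phi> j)" and c: "0 < c j" for j
    using PC[of j] by (simp_all add: line_embedding_def \<Phi>_def c_def)
  have \<Phi>_lip: "\<bar>\<phi> x y - \<phi> x' y'\<bar> \<le> c j * (norm (x - x') + r)"
    if "\<phi> \<in> \<Phi> j" "0 \<le> r" "\<bar>y - y'\<bar> \<le> reach_weight (alpha j) (abs_coord x) r" for j \<phi> x y x' y' r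
    using PC[of j] that unfolding line_embedding_def \<Phi>_def c_def by blast
  have \<Phi>_lower: "\<exists>r\<ge>0. \<bar>y - y'\<bar> \<le> reach_weight (alpha j) (abs_coord x) r \<and>
      r \<le> c j * (norm (x - x') + (\<Sum>\<phi>\<in>\<Phi> j. \<bar>\<phi> x y - \<phi> x' y'\<bar>))" for j x y x' y'
    using PC[of j] unfolding line_embedding_def \<Phi>_def c_def by blast
  define lift where "lift j \<phi> = (\<lambda>p :: (real^'n) \<times> (real^'l). \<phi> (fst p) (snd p $ j) :: real)"
    for j and \<phi> :: "real^'n \<Rightarrow> real \<Rightarrow> real"
  \<comment> \<open>The coordinates of \<open>x\<close> together with the functions embedding each
    pair of \<open>x\<close> and one \<open>y $ j\<close>.\<close>
  define \<Omega> where "\<Omega> = (\<lambda>i p. fst p $ i) ` (UNIV :: 'n set) \<union> (\<Union>j. lift j ` \<Phi> j)"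
  have fin_\<Omega>: "finite \<Omega>" using fin by (simp add: \<Omega>_def)
  \<comment> \<open>\<open>C1\<close> serves the Lipschitz bound, with \<open>2 ^ k\<close> coming
    from \<open>cc_dist_lower\<close>; \<open>C2\<close> serves the lower bound through
    \<open>cc_dist_upper\<close>.\<close>
  define C1 where "C1 = 1 + (\<Sum>j\<in>UNIV. c j * (1 + 2 ^ k))"
  define n where "n = real CARD('n)"
  define C2 where "C2 = n + (2 * n + 1) * (\<Sum>j\<in>UNIV. c j * (n + real (card (\<Phi> j))))"
  have n: "0 \<le> n" by (simp add: n_def)
  have C1: "1 \<le> C1" unfolding C1_def using c by (simp add: sum_nonneg less_imp_le)
  have C2: "0 \<le> C2"
    unfolding C2_def using c n
    by (intro add_nonneg_nonneg mult_nonneg_nonneg sum_nonneg) (auto intro: less_imp_le)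
  have cj: "c j * (1 + 2 ^ k) \<le> C1" for j
  proof -
    have "c j * (1 + 2 ^ k) \<le> (\<Sum>j\<in>UNIV. c j * (1 + 2 ^ k))"
      using c by (intro member_le_sum) (auto intro!: mult_nonneg_nonneg intro: less_imp_le)
    then show ?thesis by (simp add: C1_def)
  qed
  show ?thesis
  proof (rule bi_lipschitz_embeddable_of_finite_family[OF fin_\<Omega>, of "C1 + C2"])
    show "0 < C1 + C2" using C1 C2 by simp
  next
    fix \<omega> and p q :: "(real^'n) \<times> (real^'l)"
    assume \<omega>: "\<omega> \<in> \<Omega>"
    obtain x y where p: "p = (x, y)" by (cases p)
    obtain x' y' where q: "q = (x', y')" by (cases q)
    have bound: "\<bar>\<omega> p - \<omega> q\<bar> \<le> C1 * R" if less: "cc_dist alpha p q < ennreal R" for R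
    proof -
      have R: "0 < R" using less by (cases "0 < R") (auto simp: ennreal_neg)
      have x: "norm (x - x') \<le> R"
        using cc_dist_lower(1)[OF less[unfolded p q]] by (simp add: norm_minus_commute)
      consider i where "\<omega> = (\<lambda>p. fst p $ i)" | j \<phi> where "\<phi> \<in> \<Phi> j" "\<omega> = lift j \<phi>"
        using \<omega> by (auto simp: \<Omega>_def)
      then show ?thesis
      proof cases
        case 1
        then have "\<bar>\<omega> p - \<omega> q\<bar> \<le> norm (x - x')"
          using component_le_norm_cart[of "x - x'" i] by (simp add: p q)
        also have "\<dots> \<le> 1 * R" using x by simp
        also have "\<dots> \<le> C1 * R" using C1 R by (intro mult_right_mono) auto
        finally show ?thesis .
      next
        case 2
        have "\<bar>y $ j - y' $ j\<bar> \<le> reach_weight (alpha j) (abs_coord x) (2 ^ k * R)"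
          using cc_dist_lower(2)[OF less[unfolded p q], of j] assms[of j] by (simp add: abs_minus_commute)
        then have "\<bar>\<omega> p - \<omega> q\<bar> \<le> c j * (norm (x - x') + 2 ^ k * R)"
          using \<Phi>_lip[OF 2(1), of "2 ^ k * R"] R by (simp add: 2(2) lift_def p q)
        also have "\<dots> \<le> c j * (R + 2 ^ k * R)"
          using x c[of j] by (intro mult_left_mono) auto
        also have "\<dots> = (c j * (1 + 2 ^ k)) * R" by (simp add: algebra_simps)
        also have "\<dots> \<le> C1 * R" using cj R by (intro mult_right_mono) auto
        finally show ?thesis .
      qed
    qed
    show "ennreal \<bar>\<omega> p - \<omega> q\<bar> \<le> ennreal (C1 + C2) * cc_dist alpha p q"
    proof (cases "cc_dist alpha p q")
      case (real d)
      have "\<bar>\<omega> p - \<omega> q\<bar> \<le> C1 * d"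
      \<comment> \<open>The estimate holds for every \<open>R\<close> above the distance
        \<open>d\<close>; letting \<open>R\<close> decrease to \<open>d\<close> gives it for
        \<open>d\<close> itself.\<close>
      proof (rule field_le_epsilon)
        fix e :: real assume "0 < e"
        then have e: "0 < e / C1" using C1 by simp
        have "\<bar>\<omega> p - \<omega> q\<bar> \<le> C1 * (d + e / C1)"
          using real e by (intro bound) (simp add: ennreal_less_iff)
        then show "\<bar>\<omega> p - \<omega> q\<bar> \<le> C1 * d + e"
          using C1 by (simp add: distrib_left)
      qed
      also have "\<dots> \<le> (C1 + C2) * d"
        using C2 real by (intro mult_right_mono) auto
      finally show ?thesis
        using real C1 C2 by (simp add: ennreal_mult[symmetric] ennreal_leI del: ennreal_plus)
    next
      case top
      \<comment> \<open>At infinite distance the right-hand side is infinite, because the constant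
        is positive.\<close>
      have "0 < ennreal (C1 + C2)" using C1 C2 by (simp del: ennreal_plus)
      then show ?thesis using top by (simp add: ennreal_mult_top del: ennreal_plus)
    qed
  next
    fix p q :: "(real^'n) \<times> (real^'l)"
    obtain x y where p: "p = (x, y)" by (cases p)
    obtain x' y' where q: "q = (x', y')" by (cases q)
    define S where "S = (\<Sum>\<omega>\<in>\<Omega>. \<bar>\<omega> p - \<omega> q\<bar>)"
    have S: "\<bar>\<omega> p - \<omega> q\<bar> \<le> S" if "\<omega> \<in> \<Omega>" for \<omega>
      unfolding S_def using that fin_\<Omega> by (intro member_le_sum) auto
    have S0: "0 \<le> S" unfolding S_def by (intro sum_nonneg) auto
    have "norm (x - x') \<le> (\<Sum>i\<in>UNIV. \<bar>(x - x') $ i\<bar>)" by (rule norm_le_l1_cart)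
    also have "\<dots> \<le> (\<Sum>i\<in>(UNIV :: 'n set). S)"
    proof (rule sum_mono)
      fix i :: 'n
      have "(\<lambda>p. fst p $ i) \<in> \<Omega>" by (simp add: \<Omega>_def)
      from S[OF this] show "\<bar>(x - x') $ i\<bar> \<le> S" by (simp add: p q)
    qed
    finally have x: "norm (x - x') \<le> n * S" by (simp add: n_def)
    have "\<forall>j. \<exists>r\<ge>0. \<bar>y $ j - y' $ j\<bar> \<le> reach_weight (alpha j) (abs_coord x) r \<and>
      r \<le> c j * (norm (x - x') + (\<Sum>\<phi>\<in>\<Phi> j. \<bar>\<phi> x (y $ j) - \<phi> x' (y' $ j)\<bar>))"
      by (intro allI \<Phi>_lower)
    from choice[OF this] obtain r where r: "\<And>j. 0 \<le> r j"
      "\<And>j. \<bar>y $ j - y' $ j\<bar> \<le> reach_weight (alpha j) (abs_coord x) (r j)"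
      "\<And>j. r j \<le> c j * (norm (x - x') + (\<Sum>\<phi>\<in>\<Phi> j. \<bar>\<phi> x (y $ j) - \<phi> x' (y' $ j)\<bar>))"
      by auto
    have rj: "r j \<le> c j * (n + real (card (\<Phi> j))) * S" for j
    proof -
      have "(\<Sum>\<phi>\<in>\<Phi> j. \<bar>\<phi> x (y $ j) - \<phi> x' (y' $ j)\<bar>) \<le> (\<Sum>\<phi>\<in>\<Phi> j. S)"
      proof (rule sum_mono)
        fix \<phi> assume "\<phi> \<in> \<Phi> j"
        then have "lift j \<phi> \<in> \<Omega>" by (auto simp: \<Omega>_def)
        from S[OF this] show "\<bar>\<phi> x (y $ j) - \<phi> x' (y' $ j)\<bar> \<le> S" by (simp add: lift_def p q)
      qed
      then have "norm (x - x') + (\<Sum>\<phi>\<in>\<Phi> j. \<bar>\<phi> x (y $ j) - \<phi> x' (y' $ j)\<bar>) \<le> (n + real (card (\<Phi> j))) * S"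
        using x by (simp add: distrib_right)
      then have "c j * (norm (x - x') + (\<Sum>\<phi>\<in>\<Phi> j. \<bar>\<phi> x (y $ j) - \<phi> x' (y' $ j)\<bar>))
          \<le> c j * ((n + real (card (\<Phi> j))) * S)"
        using c[of j] by (intro mult_left_mono) auto
      with r(3)[of j] show ?thesis by (simp add: mult.assoc)
    qed
    have "(\<Sum>j\<in>UNIV. r j) \<le> (\<Sum>j\<in>UNIV. c j * (n + real (card (\<Phi> j)))) * S"
      unfolding sum_distrib_right by (intro sum_mono rj)
    then have "(2 * n + 1) * (\<Sum>j\<in>UNIV. r j)
        \<le> (2 * n + 1) * ((\<Sum>j\<in>UNIV. c j * (n + real (card (\<Phi> j)))) * S)"
      using n by (intro mult_left_mono) auto
    then have "norm (x - x') + (2 * n + 1) * (\<Sum>j\<in>UNIV. r j) \<le> C2 * S"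
      using x by (simp only: C2_def distrib_right mult.assoc)
    also have "\<dots> \<le> (C1 + C2) * S"
      using C1 S0 by (intro mult_right_mono) auto
    finally have le: "norm (x' - x) + (2 * n + 1) * (\<Sum>j\<in>UNIV. r j) \<le> (C1 + C2) * S"
      by (simp only: norm_minus_commute)
    have "cc_dist alpha p q \<le> ennreal (norm (x' - x) + (2 * n + 1) * (\<Sum>j\<in>UNIV. r j))"
      unfolding p q n_def
    proof (rule cc_dist_upper[OF r(1)])
      show "\<bar>y' $ j - y $ j\<bar> \<le> reach_weight (alpha j) (abs_coord x) (r j)" for j
        using r(2)[of j] by (simp only: abs_minus_commute)
    qed
    also have "\<dots> \<le> ennreal ((C1 + C2) * S)"
      using le by (rule ennreal_leI)
    finally show "cc_dist alpha p q \<le> ennreal ((C1 + C2) * (\<Sum>\<omega>\<in>\<Omega>. \<bar>\<omega> p - \<omega> q\<bar>))"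
      by (simp add: S_def)
  qed
qed

end
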